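(* Let $u\in W^{1,k+1}(B_1,|x|^{1-k})$ be a radial function with $g(u)\in L^1(B_1)$. Then $u$ is a weak radial solution of $S_k(D^2u)=g(u)$ in $B_1$ if and only if $$\int_{B_1}\left\{c_{n,k}|x|^{-k}(u')^{k}\,(x,\nabla \xi)+g(u)\,\xi\right\}dx=0$$ for every radially symmetric function $\xi\in C_c^{1}(B_1)$.
   Context: $n$ is a positive integer, $k\in\{1,\dots,n\}$, $B_1$ is the open unit ball of $\mathbb{R}^n$, $c_{n,k}=\binom{n}{k}/n$, $(\cdot,\cdot)$ is the Euclidean inner product, and $g:\mathbb{R}\to\mathbb{R}$ is a positive $C^1$ function. A function is radial if $u(x)=u(r)$, $r=|x|$; $u'$ is its derivative in $r$. $W^{1,k+1}(B_1,|x|^{1-k})$ is the space of weakly differentiable $u\in L^{k+1}(B_1)$ with $\int_{B_1}|x|^{1-k}|\nabla u|^{k+1}dx<\infty$. $S_k(D^2u)=\sigma_k(\lambda(D^2u))$ is the $k$-th elementary symmetric function of the eigenvalues of the Hessian $D^2u$, and $S_k^{ij}(D^2u)=\frac{\partial}{\partial u_{ij}}S_k(D^2u)$, where $u_i=u_{x_i}$, $u_{ij}=u_{x_ix_j}$. For radial $u$, with $\lambda_1=u''$ and $\lambda_2=u'/r$, one has at $x\neq0$ $$S_k^{ij}(D^2u)=k\,c_{n,k}\left(\lambda_2^{k-1}\delta_{ij}+\frac{k-1}{n-1}\lambda_2^{k-2}(\lambda_1-\lambda_2)\Big(\delta_{ij}-\frac{x_ix_j}{|x|^2}\Big)\right)$$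 (the second term is absent when $k=1$). For radial $u$ having only first weak derivatives, the expressions $\sum u_i\eta_jS_k^{ij}(D^2u)$ and $\sum u_iu_jS_k^{ij}(D^2u)$ are understood through this formula, in which $u''$ drops out: they denote $k\,c_{n,k}(u'/r)^{k}(x,\nabla\eta)$ and $k\,c_{n,k}(u'/r)^{k-1}(u')^2$, respectively. $u$ is a weak solution of $S_k(D^2u)=g(u)$ in $B_1$ if $u\in L^{k+1}(B_1)$, $\int_{B_1}\sum u_iu_jS_k^{ij}(D^2u)\,dx<\infty$, $g(u)\in L^1(B_1)$ and $$\int_{B_1}\left\{\frac1k\sum u_i\eta_jS_k^{ij}(D^2u)+g(u)\eta\right\}dx=0\quad\text{for all }\eta\in C_c^1(B_1)$$ ($\eta$ not necessarily radial). A weak radial solution is a weak solution that is radial. *)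

theory Defs
  imports "HOL-Analysis.Analysis"
begin

definition grad :: "('a::real_inner \<Rightarrow> real) \<Rightarrow> 'a \<Rightarrow> 'a"
  where "grad f x = (THE D. GDERIV f x :> D)"

(* Functions in C_c^1(U) are taken to be extended by zero to the whole space. *)
definition C1_compact_support :: "'a::euclidean_space set \<Rightarrow> ('a \<Rightarrow> real) set"
  where "C1_compact_support U =
    {f. (\<forall>x. GDERIV f x :> grad f x) \<and> continuous_on UNIV (grad f) \<and>
        compact (closure {x. f x \<noteq> 0}) \<and> closure {x. f x \<noteq> 0} \<subseteq> U}"

definition locally_integrable_on ::
    "('a::euclidean_space \<Rightarrow> 'b::euclidean_space) \<Rightarrow> 'a set \<Rightarrow> bool"
  where "locally_integrable_on f U \<longleftrightarrow>
    (\<forall>K. compact K \<and> K \<subseteq> U \<longrightarrow> integrable (lebesgue_on K) f)"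

(* G is the weak gradient of u on the open set U.  On the real line Basis = {1}
   and the inner product is multiplication, so this is the usual weak derivative. *)
definition has_weak_gradient_on ::
    "('a::euclidean_space \<Rightarrow> real) \<Rightarrow> ('a \<Rightarrow> 'a) \<Rightarrow> 'a set \<Rightarrow> bool"
  where "has_weak_gradient_on u G U \<longleftrightarrow>
    locally_integrable_on u U \<and> locally_integrable_on G U \<and>
    (\<forall>\<phi> \<in> C1_compact_support U. \<forall>i \<in> Basis.
       (LINT x|lebesgue_on U. u x * (grad \<phi> x \<bullet> i)) =
       - (LINT x|lebesgue_on U. (G x \<bullet> i) * \<phi> x))"

abbreviation unit_ball :: "'a::euclidean_space set"
  where "unit_ball \<equiv> ball 0 1"

definition Lp_on :: "nat \<Rightarrow> 'a::euclidean_space set \<Rightarrow> ('a \<Rightarrow> real) set"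
  where "Lp_on p U =
    {u. u \<in> borel_measurable (lebesgue_on U) \<and> integrable (lebesgue_on U) (\<lambda>x. \<bar>u x\<bar> ^ p)}"

(* W^{1,k+1}(B_1, |x|^{1-k}) *)
definition weighted_sobolev :: "nat \<Rightarrow> ('a::euclidean_space \<Rightarrow> real) set"
  where "weighted_sobolev k =
    {u. u \<in> Lp_on (k + 1) unit_ball \<and>
        (\<exists>G. has_weak_gradient_on u G unit_ball \<and>
             integrable (lebesgue_on unit_ball)
               (\<lambda>x. norm x powi (1 - int k) * norm (G x) ^ (k + 1)))}"

(* v is the profile of u: u(x) = v(|x|).  Only the almost-everywhere class of u matters. *)
definition radial_profile :: "('a::euclidean_space \<Rightarrow> real) \<Rightarrow> (real \<Rightarrow> real) \<Rightarrow> bool"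
  where "radial_profile u v \<longleftrightarrow> (AE x in lebesgue_on unit_ball. u x = v (norm x))"

definition radial :: "('a::euclidean_space \<Rightarrow> real) \<Rightarrow> bool"
  where "radial u \<longleftrightarrow> (\<exists>v. radial_profile u v)"

(* u' as a function of r: the weak derivative on (0,1) of the profile of u.
   It is determined up to a null set, hence the choice of a representative. *)
definition radial_deriv :: "('a::euclidean_space \<Rightarrow> real) \<Rightarrow> real \<Rightarrow> real"
  where "radial_deriv u =
    (SOME w. \<exists>v. radial_profile u v \<and> has_weak_gradient_on v w {0<..<1})"

definition c_nk :: "nat \<Rightarrow> nat \<Rightarrow> real"
  where "c_nk n k = real (n choose k) / real n"

(* S_k^{ij}(D^2 u) at x for radial u, with l1 = u'' and l2 = u'/r.
   For k = 1 the factor real (k - 1) removes the second term. *)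
definition Sk_ij :: "nat \<Rightarrow> real \<Rightarrow> real \<Rightarrow> real^'n \<Rightarrow> 'n \<Rightarrow> 'n \<Rightarrow> real"
  where "Sk_ij k l1 l2 x i j =
    real k * c_nk CARD('n) k *
      (l2 ^ (k - 1) * (if i = j then 1 else 0) +
       real (k - 1) / real (CARD('n) - 1) * l2 ^ (k - 2) * (l1 - l2) *
         ((if i = j then 1 else 0) - x $ i * x $ j / (norm x)\<^sup>2))"

(* The sum of u_i eta_j S_k^{ij}(D^2 u) over i, j.  It contains no second derivative
   of u: see sum_Sk_ij below, where u_i = (u'/r) x_i. *)
definition Sk_flux :: "nat \<Rightarrow> (real^'n \<Rightarrow> real) \<Rightarrow> (real^'n \<Rightarrow> real) \<Rightarrow> real^'n \<Rightarrow> real"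
  where "Sk_flux k u \<eta> x =
    real k * c_nk CARD('n) k * (radial_deriv u (norm x) / norm x) ^ k * (x \<bullet> grad \<eta> x)"

(* The sum of u_i u_j S_k^{ij}(D^2 u) over i, j: see sum_Sk_ij_energy. *)
definition Sk_energy :: "nat \<Rightarrow> (real^'n \<Rightarrow> real) \<Rightarrow> real^'n \<Rightarrow> real"
  where "Sk_energy k u x =
    real k * c_nk CARD('n) k * (radial_deriv u (norm x) / norm x) ^ (k - 1) *
      (radial_deriv u (norm x))\<^sup>2"

lemma sum_Sk_ij:
  fixes x y :: "real^'n"
  assumes "x \<noteq> 0" "1 \<le> k"
  shows "(\<Sum>i\<in>UNIV. \<Sum>j\<in>UNIV. (l2 * x $ i) * y $ j * Sk_ij k l1 l2 x i j) =
    real k * c_nk CARD('n) k * l2 ^ k * (x \<bullet> y)"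
proof -
  define A where "A = real k * c_nk CARD('n) k"
  define B where "B = real (k - 1) / real (CARD('n) - 1) * l2 ^ (k - 2) * (l1 - l2)"
  have nx: "(norm x)\<^sup>2 = (\<Sum>i\<in>UNIV. x $ i * x $ i)"
    by (simp add: power2_norm_eq_inner inner_vec_def)
  have row: "(\<Sum>i\<in>UNIV. x $ i * ((if i = j then 1 else 0) - x $ i * x $ j / (norm x)\<^sup>2)) = 0"
    for j
  proof -
    have "(\<Sum>i\<in>UNIV. x $ i * ((if i = j then 1 else 0) - x $ i * x $ j / (norm x)\<^sup>2)) =
        (\<Sum>i\<in>UNIV. (if i = j then x $ j else 0) - x $ i * x $ i * (x $ j / (norm x)\<^sup>2))"
      by (intro sum.cong) (auto simp: algebra_simps)
    also have "\<dots> = x $ j - (\<Sum>i\<in>UNIV. x $ i * x $ i) * (x $ j / (norm x)\<^sup>2)"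
      by (simp only: sum_subtractf sum_distrib_right[symmetric]) simp
    also have "\<dots> = 0"
      using assms(1) by (simp add: nx[symmetric])
    finally show ?thesis .
  qed
  have "(\<Sum>i\<in>UNIV. \<Sum>j\<in>UNIV. (l2 * x $ i) * y $ j * Sk_ij k l1 l2 x i j) =
      (\<Sum>j\<in>UNIV. \<Sum>i\<in>UNIV. (l2 * x $ i) * y $ j * Sk_ij k l1 l2 x i j)"
    by (rule sum.swap)
  also have "\<dots> = (\<Sum>j\<in>UNIV. A * l2 * l2 ^ (k - 1) * (x $ j * y $ j))"
  proof (rule sum.cong)
    fix j :: 'n
    have "(\<Sum>i\<in>UNIV. (l2 * x $ i) * y $ j * Sk_ij k l1 l2 x i j) =
      (\<Sum>i\<in>UNIV. A * l2 * l2 ^ (k - 1) * y $ j * (x $ i * (if i = j then 1 else 0)) +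
        A * B * l2 * y $ j * (x $ i * ((if i = j then 1 else 0) - x $ i * x $ j / (norm x)\<^sup>2)))"
      unfolding Sk_ij_def A_def[symmetric] B_def[symmetric]
      by (intro sum.cong) (auto simp: algebra_simps)
    also have "\<dots> = A * l2 * l2 ^ (k - 1) * y $ j * (\<Sum>i\<in>UNIV. x $ i * (if i = j then 1 else 0))"
      unfolding sum.distrib sum_distrib_left[symmetric] row by simp
    also have "(\<Sum>i\<in>UNIV. x $ i * (if i = j then 1 else 0)) = x $ j"
      by (simp add: if_distrib[of "\<lambda>t. _ * t"] cong: if_cong)
    finally show "(\<Sum>i\<in>UNIV. (l2 * x $ i) * y $ j * Sk_ij k l1 l2 x i j) =
        A * l2 * l2 ^ (k - 1) * (x $ j * y $ j)"
      by (simp add: mult_ac)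
  qed simp
  also have "\<dots> = A * (l2 * l2 ^ (k - 1)) * (x \<bullet> y)"
    by (simp add: sum_distrib_left inner_vec_def mult_ac)
  also have "l2 * l2 ^ (k - 1) = l2 ^ k"
    using assms(2) by (cases k) auto
  finally show ?thesis
    by (simp add: A_def)
qed

lemma sum_Sk_ij_energy:
  fixes x :: "real^'n"
  assumes "x \<noteq> 0" "1 \<le> k" and l2: "l2 = d / norm x"
  shows "(\<Sum>i\<in>UNIV. \<Sum>j\<in>UNIV. (l2 * x $ i) * (l2 * x $ j) * Sk_ij k l1 l2 x i j) =
    real k * c_nk CARD('n) k * l2 ^ (k - 1) * d\<^sup>2"
proof -
  have d: "d = l2 * norm x"
    using assms by simp
  have "l2 ^ k = l2 ^ (k - 1) * l2"
    using assms(2) by (cases k) auto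
  with sum_Sk_ij[OF assms(1,2), of l2 "l2 *\<^sub>R x" l1] show ?thesis
    by (simp add: d power2_norm_eq_inner[symmetric] power_mult_distrib power2_eq_square mult_ac)
qed

(* Radial weak solutions of S_k(D^2 u) = g(u) in B_1.  The test functions need not be radial.
   has_bochner_integral M f 0 says that f is integrable over M with integral 0. *)
definition weak_radial_solution ::
    "nat \<Rightarrow> (real \<Rightarrow> real) \<Rightarrow> (real^'n \<Rightarrow> real) \<Rightarrow> bool"
  where "weak_radial_solution k g u \<longleftrightarrow>
    radial u \<and> (\<exists>G. has_weak_gradient_on u G unit_ball) \<and>
    u \<in> Lp_on (k + 1) unit_ball \<and>
    integrable (lebesgue_on unit_ball) (Sk_energy k u) \<and>
    integrable (lebesgue_on unit_ball) (\<lambda>x. g (u x)) \<and>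
    (\<forall>\<eta> \<in> C1_compact_support unit_ball.
       has_bochner_integral (lebesgue_on unit_ball)
         (\<lambda>x. 1 / real k * Sk_flux k u \<eta> x + g (u x) * \<eta> x) 0)"

end

theory Submission
  imports Defs "HOL-Probability.Probability_Measure"
begin

text \<open>
  Radial test functions are test functions, and the two integrands agree pointwise, so one direction
  is immediate.  For the converse, the flux of a radial function against $\eta$ involves $\eta$ only
  through its radial derivative $\partial_r\eta = (x/|x|, \nabla\eta)$: up to null sets the integrand is
  $f(|x|)\,\partial_r\eta + h(|x|)\,\eta$ with $f(r) = c_{n,k}\,r^{1-k}(u')^k$ and $h = g(u)$.  Against a
  radial factor a function and its spherical mean have the same integral
  (\<open>sph_avg_mult\<close>).  The spherical mean $\xi$ of $\eta$ is a radial $C_c^1$ function, whose radial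
  derivative is the spherical mean of $\partial_r\eta$ (\<open>radial_mean_test_function\<close>); it is
  differentiable at the origin because the directions average to 0.  So the identity for $\xi$ is the
  identity for $\eta$.

  Spherical means are taken with respect to the direction of a uniformly distributed point $y$ of the
  unit ball, so that no surface measure enters: the mean of $F$ over the sphere of radius $r$ is the
  expectation of $F(r\,y/|y|)$.  Polar coordinates become the statement that norm and direction of a
  uniformly distributed point are independent (\<open>distr_norm_sgn\<close>), which is the scaling law of
  Lebesgue measure.

  The analytic work lies in the radial derivative $u'$, which is chosen among the weak derivatives of
  profiles of $u$.  Testing the weak gradient $G$ of $u$ with the vector fields
  $|x|^{-n}\varphi(|x|)\,x$, whose divergence is $|x|^{1-n}\varphi'(|x|)$, shows that the spherical mean of
  $(G, x/|x|)$ is a weak derivative of the spherical mean of $u$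
  (\<open>weak_gradient_sph_avg\<close>).  Weak derivatives on an interval are unique
  (\<open>weak_derivative_unique\<close>), so $u'$ is that spherical mean almost everywhere.  By Jensen's
  inequality $|x|^{1-k}|u'|^{k+1}$ is integrable over the ball.  This is the finiteness of the energy,
  and together with the integrability of $|x|^{1-k}$, which holds as $k \le n$, it makes the flux
  integrable against every test function.
\<close>

section \<open>Polar coordinates for the uniform distribution on the unit ball\<close>

text \<open>The uniform distribution on the unit ball takes the place of surface measure: its norm is
  spread over $(0,1)$, its direction over the sphere, and the two are independent.\<close>
definition unif_ball :: "'a::euclidean_space measure"
  where "unif_ball = uniform_measure lborel (ball 0 1)"

lemma emeasure_unit_ball:
  "emeasure lborel (ball 0 1 :: 'a::euclidean_space set) \<noteq> 0"
  "emeasure lborel (ball 0 1 :: 'a::euclidean_space set) \<noteq> \<infinity>"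
  by (auto simp: emeasure_ball less_imp_neq[OF unit_ball_vol_pos, symmetric])

lemma space_unif_ball [simp]: "space unif_ball = UNIV"
  and sets_unif_ball [simp, measurable_cong]: "sets unif_ball = sets borel"
  by (auto simp: unif_ball_def)

lemma prob_space_unif_ball: "prob_space (unif_ball :: 'a::euclidean_space measure)"
  unfolding unif_ball_def by (rule prob_space_uniform_measure) (use emeasure_unit_ball[where ?'a='a] in auto)

interpretation ub: prob_space "unif_ball :: 'a::euclidean_space measure"
  by (rule prob_space_unif_ball)

interpretation ubp: pair_sigma_finite
    "unif_ball :: 'a::euclidean_space measure" "unif_ball :: 'a::euclidean_space measure"
  ..

lemma AE_unif_ball_iff:
  "(AE x in unif_ball. P (x::'a::euclidean_space)) \<longleftrightarrow> (AE x in lborel. norm x < 1 \<longrightarrow> P x)"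
  unfolding unif_ball_def by (subst AE_uniform_measure) (use emeasure_unit_ball[where ?'a='a] in \<open>auto simp: less_top\<close>)

lemma AE_unif_ball_norm: "AE x in (unif_ball :: 'a::euclidean_space measure). 0 < norm x \<and> norm x < 1"
proof -
  have "AE x in lborel. x \<noteq> (0::'a)"
    by (rule AE_lborel_singleton)
  then show ?thesis
    unfolding AE_unif_ball_iff by eventually_elim auto
qed

lemma AE_unif_ball_norm_neq:
  "AE x in (unif_ball :: 'a::euclidean_space measure). norm x \<noteq> r"
proof -
  have "sphere (0::'a) r \<in> null_sets lborel"
    using negligible_sphere[of "0::'a" r]
    by (auto simp: null_sets_completion_iff negligible_iff_null_sets)
  then have "AE x in lborel. x \<notin> sphere (0::'a) r"
    by (rule AE_not_in)
  then show ?thesis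
    unfolding AE_unif_ball_iff by eventually_elim auto
qed

text \<open>The points of a given set of directions with norm below $r$ are the image of those with
  norm below 1 under scaling by $r$, which multiplies Lebesgue measure by $r^n$.  The product on
  the right is what makes norm and direction independent.\<close>
lemma prob_norm_less_sgn:
  fixes A :: "'a::euclidean_space set"
  assumes [measurable]: "A \<in> sets borel" and r: "0 < r" "r \<le> 1"
  shows "ub.prob {x. norm x < r \<and> sgn x \<in> A} = r ^ DIM('a) * ub.prob {x. sgn x \<in> A}"
proof -
  define S where "S s = ball 0 s \<inter> sgn -` A" for s :: real
  have [measurable]: "{x. sgn x \<in> A} \<in> sets borel" "{x. norm x < r \<and> sgn x \<in> A} \<in> sets borel"
    by measurable
  have S [measurable]: "S s \<in> sets borel" for s
  proof -
    have "S s = {x. norm x < s \<and> sgn x \<in> A}"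
      by (auto simp: S_def)
    also have "\<dots> \<in> sets borel"
      by measurable
    finally show ?thesis .
  qed
  have "S r = (\<lambda>x. r *\<^sub>R x + 0) ` S 1"
  proof (intro equalityI subsetI)
    fix x assume "x \<in> S r"
    with r show "x \<in> (\<lambda>x. r *\<^sub>R x + 0) ` S 1"
      by (intro image_eqI[where x = "x /\<^sub>R r"]) (auto simp: S_def sgn_scaleR field_simps)
  qed (use r in \<open>auto simp: S_def sgn_scaleR\<close>)
  then have "measure lebesgue (S r) = r ^ DIM('a) * measure lebesgue (S 1)"
    using measure_lebesgue_affine[of r "0::'a" "S 1"] r by simp
  then have "measure lborel (S r) = r ^ DIM('a) * measure lborel (S 1)"
    by simp
  moreover have "ball 0 1 \<inter> {x. norm x < r \<and> sgn x \<in> A} = S r" "ball 0 1 \<inter> {x. sgn x \<in> A} = S 1"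
    using r by (auto simp: S_def)
  ultimately show ?thesis
    unfolding unif_ball_def
    by (subst (1 2) measure_uniform_measure) (use emeasure_unit_ball[where ?'a='a] in auto)
qed

lemma prob_norm_greater_sgn:
  fixes A :: "'a::euclidean_space set"
  assumes [measurable]: "A \<in> sets borel" and r: "0 < r" "r \<le> 1"
  shows "ub.prob {x. r < norm x \<and> sgn x \<in> A} = (1 - r ^ DIM('a)) * ub.prob {x. sgn x \<in> A}"
proof -
  have [measurable]: "{x. sgn x \<in> A} \<in> sets borel" "{x. norm x < r \<and> sgn x \<in> A} \<in> sets borel"
    "{x. r < norm x \<and> sgn x \<in> A} \<in> sets borel"
    by measurable
  have "ub.prob {x. sgn x \<in> A} = ub.prob ({x. r < norm x \<and> sgn x \<in> A} \<union> {x. norm x < r \<and> sgn x \<in> A})"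
    using AE_unif_ball_norm_neq[of r]
    by (intro ub.finite_measure_eq_AE) (auto elim!: eventually_mono)
  also have "\<dots> = ub.prob {x. r < norm x \<and> sgn x \<in> A} + ub.prob {x. norm x < r \<and> sgn x \<in> A}"
    by (rule ub.finite_measure_Union) auto
  finally show ?thesis
    using prob_norm_less_sgn[OF assms] by (simp add: algebra_simps)
qed

lemma prob_norm_greater:
  assumes r: "0 < r" "r \<le> 1"
  shows "ub.prob {x::'a::euclidean_space. r < norm x} = 1 - r ^ DIM('a)"
  using prob_norm_greater_sgn[of "UNIV :: 'a set" r] r ub.prob_space[where ?'a='a] by simp

text \<open>Independence of norm and direction.  For a fixed set of directions both sides are finite
  measures in the radial variable that agree on all half-lines.\<close>
lemma distr_norm_sgn:
  "distr unif_ball (borel \<Otimes>\<^sub>M borel) (\<lambda>x::'a::euclidean_space. (norm x, sgn x)) =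
    distr unif_ball borel (norm :: 'a \<Rightarrow> real) \<Otimes>\<^sub>M distr unif_ball borel (sgn :: 'a \<Rightarrow> 'a)"
proof (rule pair_measure_eqI[symmetric])
  show "sigma_finite_measure (distr unif_ball borel (norm :: 'a \<Rightarrow> real))"
    by (intro prob_space_imp_sigma_finite ub.prob_space_distr) simp
  show "sigma_finite_measure (distr unif_ball borel (sgn :: 'a \<Rightarrow> 'a))"
    by (intro prob_space_imp_sigma_finite ub.prob_space_distr) simp
  show "sets (distr unif_ball borel (norm :: 'a \<Rightarrow> real) \<Otimes>\<^sub>M distr unif_ball borel (sgn :: 'a \<Rightarrow> 'a)) =
      sets (distr unif_ball (borel \<Otimes>\<^sub>M borel) (\<lambda>x::'a. (norm x, sgn x)))"
    by (simp cong: sets_pair_measure_cong)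
  fix A :: "real set" and B :: "'a set"
  assume "A \<in> sets (distr unif_ball borel (norm :: 'a \<Rightarrow> real))"
    and "B \<in> sets (distr unif_ball borel (sgn :: 'a \<Rightarrow> 'a))"
  then have [measurable]: "A \<in> sets borel" "B \<in> sets borel"
    by auto
  define b where "b = ub.prob {x. sgn x \<in> B}"
  have [measurable]: "{x. sgn x \<in> B} \<in> sets borel"
    by measurable
  \<comment> \<open>$M$ is the law of the norm on the event that the direction lies in $B$.\<close>
  define M where "M = distr (density unif_ball (indicator {x. sgn x \<in> B})) borel (norm :: 'a \<Rightarrow> real)"
  define N where "N = density (distr unif_ball borel (norm :: 'a \<Rightarrow> real)) (\<lambda>_. ennreal b)"
  have emM: "emeasure M X = ub.prob {x. norm x \<in> X \<and> sgn x \<in> B}" if [measurable]: "X \<in> sets borel" for X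
  proof -
    have "emeasure M X = emeasure unif_ball ({x. sgn x \<in> B} \<inter> norm -` X)"
    proof -
      have [measurable]: "norm -` X \<in> sets (borel :: 'a measure)"
        by (rule measurable_sets_borel[of _ borel]) auto
      have "emeasure M X = (\<integral>\<^sup>+x. indicator {x. sgn x \<in> B} x * indicator (norm -` X) x \<partial>unif_ball)"
        unfolding M_def by (subst emeasure_distr) (auto simp: emeasure_density)
      also have "\<dots> = (\<integral>\<^sup>+x. indicator ({x. sgn x \<in> B} \<inter> norm -` X) x \<partial>unif_ball)"
        by (simp add: indicator_inter_arith)
      also have "\<dots> = emeasure unif_ball ({x. sgn x \<in> B} \<inter> norm -` X)"
        by (rule nn_integral_indicator) simp
      finally show ?thesis .
    qed
    also have "{x. sgn x \<in> B} \<inter> norm -` X = {x. norm x \<in> X \<and> sgn x \<in> B}"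
      by auto
    finally show ?thesis
      by (simp add: ub.emeasure_eq_measure)
  qed
  have emN: "emeasure N X = ub.prob {x::'a. norm x \<in> X} * b" if [measurable]: "X \<in> sets borel" for X
    unfolding N_def
    by (subst mult.commute) (simp add: emeasure_density nn_integral_cmult_indicator emeasure_distr
          vimage_def ub.emeasure_eq_measure b_def ennreal_mult)
  have "M = N"
  proof (rule measure_eqI_lessThan)
    show "sets M = sets borel" "sets N = sets borel"
      by (auto simp: M_def N_def)
    show "emeasure M {r<..} < \<infinity>" for r
      by (subst emM) auto
    show "emeasure M {r<..} = emeasure N {r<..}" for r
    proof -
      consider "r \<le> 0" | "0 < r" "r \<le> 1" | "1 < r" by linarith
      then have "ub.prob {x. norm x \<in> {r<..} \<and> sgn x \<in> B} = ub.prob {x::'a. norm x \<in> {r<..}} * b"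
      proof cases
        case 1
        have "ub.prob {x::'a. norm x \<in> {r<..} \<and> sgn x \<in> B} = ub.prob {x. sgn x \<in> B}"
          by (intro ub.finite_measure_eq_AE eventually_mono[OF AE_unif_ball_norm])
            (use 1 in \<open>auto intro: le_less_trans\<close>)
        moreover have "ub.prob {x::'a. norm x \<in> {r<..}} = ub.prob (UNIV :: 'a set)"
          by (intro ub.finite_measure_eq_AE eventually_mono[OF AE_unif_ball_norm])
            (use 1 in \<open>auto intro: le_less_trans\<close>)
        ultimately show ?thesis
          using ub.prob_space[where ?'a='a] by (simp add: b_def)
      next
        case 2
        then show ?thesis
          using prob_norm_greater_sgn[of B r] prob_norm_greater[of r, where ?'a='a] by (simp add: b_def)
      next
        case 3
        have "ub.prob {x::'a. norm x \<in> {r<..} \<and> sgn x \<in> B} = ub.prob ({} :: 'a set)"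
          by (intro ub.finite_measure_eq_AE eventually_mono[OF AE_unif_ball_norm]) (use 3 in auto)
        moreover have "ub.prob {x::'a. norm x \<in> {r<..}} = ub.prob ({} :: 'a set)"
          by (intro ub.finite_measure_eq_AE eventually_mono[OF AE_unif_ball_norm]) (use 3 in auto)
        ultimately show ?thesis
          by simp
      qed
      then show ?thesis
        by (simp add: emM emN del: greaterThan_iff)
    qed
  qed
  then have "emeasure M A = emeasure N A"
    by simp
  then have eq: "ub.prob {x. norm x \<in> A \<and> sgn x \<in> B} = ub.prob {x::'a. norm x \<in> A} * b"
    by (simp add: emM emN b_def)
  have "emeasure (distr unif_ball borel (norm :: 'a \<Rightarrow> real)) A *
      emeasure (distr unif_ball borel (sgn :: 'a \<Rightarrow> 'a)) B =
      ennreal (ub.prob {x::'a. norm x \<in> A} * b)"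
    by (simp add: emeasure_distr vimage_def ub.emeasure_eq_measure b_def ennreal_mult)
  also have "\<dots> = emeasure (distr unif_ball (borel \<Otimes>\<^sub>M borel) (\<lambda>x::'a. (norm x, sgn x))) (A \<times> B)"
    by (subst emeasure_distr) (auto simp: eq[symmetric] vimage_def ub.emeasure_eq_measure)
  finally show "emeasure (distr unif_ball borel (norm :: 'a \<Rightarrow> real)) A *
      emeasure (distr unif_ball borel (sgn :: 'a \<Rightarrow> 'a)) B =
    emeasure (distr unif_ball (borel \<Otimes>\<^sub>M borel) (\<lambda>x::'a. (norm x, sgn x))) (A \<times> B)" .
qed

text \<open>Polar coordinates: by independence, the norm of one random point may be combined with
  the direction of another one, and the result is again uniformly distributed.  Applying Fubini to
  this identity separates the radial from the angular integration.\<close>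
lemma distr_norm_scaleR_sgn:
  "distr (unif_ball \<Otimes>\<^sub>M unif_ball) borel (\<lambda>(x::'a, y::'a). norm x *\<^sub>R sgn y) =
    (unif_ball :: 'a::euclidean_space measure)"
proof -
  let ?m = "\<lambda>p::real \<times> 'a. fst p *\<^sub>R snd p"
  have m: "?m \<in> borel \<Otimes>\<^sub>M borel \<rightarrow>\<^sub>M borel"
    by measurable
  have "distr unif_ball borel (norm :: 'a \<Rightarrow> real) \<Otimes>\<^sub>M distr unif_ball borel (sgn :: 'a \<Rightarrow> 'a) =
      distr (unif_ball \<Otimes>\<^sub>M unif_ball) (borel \<Otimes>\<^sub>M borel) (\<lambda>(x::'a, y::'a). (norm x, sgn y))"
    by (rule pair_measure_distr) (auto intro!: prob_space_imp_sigma_finite ub.prob_space_distr)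
  then have "distr unif_ball (borel \<Otimes>\<^sub>M borel) (\<lambda>x::'a. (norm x, sgn x)) =
      distr (unif_ball \<Otimes>\<^sub>M unif_ball) (borel \<Otimes>\<^sub>M borel) (\<lambda>(x::'a, y::'a). (norm x, sgn y))"
    using distr_norm_sgn[where ?'a='a] by simp
  then have "distr (distr unif_ball (borel \<Otimes>\<^sub>M borel) (\<lambda>x::'a. (norm x, sgn x))) borel ?m =
      distr (distr (unif_ball \<Otimes>\<^sub>M unif_ball) (borel \<Otimes>\<^sub>M borel) (\<lambda>(x::'a, y::'a). (norm x, sgn y))) borel ?m"
    by simp
  then have "distr unif_ball borel (\<lambda>x::'a. norm x *\<^sub>R sgn x) =
      distr (unif_ball \<Otimes>\<^sub>M unif_ball) borel (\<lambda>(x::'a, y::'a). norm x *\<^sub>R sgn y)"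
    using m by (simp add: distr_distr comp_def split_beta')
  moreover have "norm x *\<^sub>R sgn x = x" for x :: 'a
    by (cases "x = 0") (auto simp: sgn_div_norm)
  ultimately show ?thesis
    by (simp add: distr_id2)
qed

section \<open>Spherical means\<close>

text \<open>The mean of $F$ over the sphere of radius $r$, since the direction of a uniformly
  distributed point is uniform on the unit sphere.\<close>
definition sph_avg :: "('a::euclidean_space \<Rightarrow> real) \<Rightarrow> real \<Rightarrow> real"
  where "sph_avg F r = (\<integral>y. F (r *\<^sub>R sgn y) \<partial>unif_ball)"

lemma integrable_polar:
  fixes F :: "'a::euclidean_space \<Rightarrow> real"
  assumes "integrable unif_ball F"
  shows "integrable (unif_ball \<Otimes>\<^sub>M unif_ball) (\<lambda>(x::'a, y). F (norm x *\<^sub>R sgn y))"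
    and "(\<integral>p. F (norm (fst p) *\<^sub>R sgn (snd p)) \<partial>((unif_ball :: 'a measure) \<Otimes>\<^sub>M unif_ball)) = integral\<^sup>L unif_ball F"
proof -
  let ?m = "\<lambda>(x::'a, y::'a). norm x *\<^sub>R sgn y"
  have m: "?m \<in> unif_ball \<Otimes>\<^sub>M unif_ball \<rightarrow>\<^sub>M borel"
    by measurable
  have F: "integrable (distr (unif_ball \<Otimes>\<^sub>M unif_ball) borel ?m) F"
    using assms by (simp add: distr_norm_scaleR_sgn)
  show "integrable (unif_ball \<Otimes>\<^sub>M unif_ball) (\<lambda>(x::'a, y). F (norm x *\<^sub>R sgn y))"
    using integrable_distr[OF m F] by (simp add: split_beta')
  have "integral\<^sup>L (distr (unif_ball \<Otimes>\<^sub>M unif_ball) borel ?m) F =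
      (\<integral>p. F (?m p) \<partial>(unif_ball \<Otimes>\<^sub>M unif_ball))"
    by (rule integral_distr[OF m]) (use borel_measurable_integrable[OF assms] in simp)
  then show "(\<integral>p. F (norm (fst p) *\<^sub>R sgn (snd p)) \<partial>((unif_ball :: 'a measure) \<Otimes>\<^sub>M unif_ball)) = integral\<^sup>L unif_ball F"
    unfolding distr_norm_scaleR_sgn by (simp add: split_beta')
qed

lemma borel_measurable_sph_avg [measurable]:
  fixes F :: "'a::euclidean_space \<Rightarrow> real"
  assumes [measurable]: "F \<in> borel_measurable borel"
  shows "sph_avg F \<in> borel_measurable borel"
  unfolding sph_avg_def[abs_def] by measurable

text \<open>Only almost every $y$ qualifies, because the direction of the origin is 0.\<close>
lemma norm_scaleR_sgn_AE:
  "AE y in (unif_ball :: 'a::euclidean_space measure). norm (norm (x::'a) *\<^sub>R sgn y) = norm x"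
  by (rule eventually_mono[OF AE_unif_ball_norm]) (simp add: norm_sgn)

text \<open>The reduction to radial test functions rests on this: a radial factor is constant on
  spheres, so against it a function and its spherical mean have the same integral.\<close>
lemma sph_avg_mult:
  fixes H :: "'a::euclidean_space \<Rightarrow> real"
  assumes f [measurable]: "f \<in> borel_measurable borel" and H [measurable]: "H \<in> borel_measurable borel"
    and int: "integrable unif_ball (\<lambda>x. f (norm x) * H x)"
  shows "integrable (unif_ball :: 'a measure) (\<lambda>x. f (norm x) * sph_avg H (norm x))"
    and "(\<integral>x. f (norm x) * sph_avg H (norm x) \<partial>(unif_ball :: 'a measure)) =
      (\<integral>x. f (norm x) * H x \<partial>unif_ball)"
proof -
  have eq: "(\<integral>y. f (norm (norm x *\<^sub>R sgn y)) * H (norm x *\<^sub>R sgn y) \<partial>unif_ball) =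
      f (norm x) * sph_avg H (norm x)" for x :: 'a
  proof -
    have "(\<integral>y. f (norm (norm x *\<^sub>R sgn y)) * H (norm x *\<^sub>R sgn y) \<partial>unif_ball) =
        (\<integral>y. f (norm x) * H (norm x *\<^sub>R sgn y) \<partial>unif_ball)"
    proof (rule integral_cong_AE)
      show "AE y in unif_ball. f (norm (norm x *\<^sub>R sgn y)) * H (norm x *\<^sub>R sgn y) =
          f (norm x) * H (norm x *\<^sub>R sgn y)"
        by (rule eventually_mono[OF norm_scaleR_sgn_AE[of x]]) (simp only:)
    qed measurable
    then show ?thesis
      by (simp add: sph_avg_def)
  qed
  note P = integrable_polar[OF int]
  show "integrable (unif_ball :: 'a measure) (\<lambda>x. f (norm x) * sph_avg H (norm x))"
    using ubp.integrable_fst[OF P(1)] by (simp only: eq)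
  show "(\<integral>x. f (norm x) * sph_avg H (norm x) \<partial>(unif_ball :: 'a measure)) =
      (\<integral>x. f (norm x) * H x \<partial>unif_ball)"
    using ubp.integral_fst[OF P(1)] P(2) by (simp only: eq split_beta')
qed

text \<open>Radiality holds almost everywhere only, and $v$ is arbitrary.  Polar coordinates turn the
  exceptional null set into one that meets almost every sphere in a null set.  In particular the
  spherical mean is a Borel profile.\<close>
lemma sph_avg_radial:
  fixes u :: "'a::euclidean_space \<Rightarrow> real"
  assumes [measurable]: "u \<in> borel_measurable borel"
    and ae: "AE x in unif_ball. u x = v (norm x)"
  shows "AE x in (unif_ball :: 'a measure). sph_avg u (norm x) = v (norm x)"
proof -
  let ?m = "\<lambda>(x::'a, y::'a). norm x *\<^sub>R sgn y"
  have m: "?m \<in> unif_ball \<Otimes>\<^sub>M unif_ball \<rightarrow>\<^sub>M borel"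
    by measurable
  have "AE x in distr (unif_ball \<Otimes>\<^sub>M unif_ball) borel ?m. u x = v (norm x)"
    unfolding distr_norm_scaleR_sgn by (rule ae)
  from ubp.AE_pair[OF AE_distrD[OF m this]]
  have "AE x in unif_ball. AE y in unif_ball. u (norm (x::'a) *\<^sub>R sgn y) = v (norm (norm x *\<^sub>R sgn y))"
    by simp
  then show ?thesis
  proof eventually_elim
    case (elim x)
    have "AE y in unif_ball. u (norm x *\<^sub>R sgn y) = v (norm x)"
      using elim norm_scaleR_sgn_AE[of x] by eventually_elim (simp only:)
    then have "sph_avg u (norm x) = (\<integral>y. v (norm x) \<partial>(unif_ball :: 'a measure))"
      unfolding sph_avg_def by (intro integral_cong_AE) measurable
    then show ?case
      using ub.prob_space[where ?'a='a] by simp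
  qed
qed

lemma convex_on_abs_power: "convex_on UNIV (\<lambda>x::real. \<bar>x\<bar> ^ p)"
proof (cases "p = 0")
  case False
  show ?thesis
  proof (rule convex_onI)
    fix t x y :: real assume t: "0 < t" "t < 1"
    have "\<bar>(1 - t) *\<^sub>R x + t *\<^sub>R y\<bar> ^ p \<le> ((1 - t) * \<bar>x\<bar> + t * \<bar>y\<bar>) ^ p"
      using t by (intro power_mono order.trans[OF abs_triangle_ineq]) (auto simp: abs_mult)
    also have "\<dots> \<le> (1 - t) * \<bar>x\<bar> ^ p + t * \<bar>y\<bar> ^ p"
    proof -
      have "convex_on {0..} (\<lambda>x::real. x ^ p)"
      proof (cases "even p")
        case True
        then show ?thesis
          by (rule convex_on_subset[OF convex_power_even]) auto
      next
        case False
        then show ?thesis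
          by (rule convex_power_odd)
      qed
      from convex_onD[OF this, of t "\<bar>x\<bar>" "\<bar>y\<bar>"] t show ?thesis
        by simp
    qed
    finally show "\<bar>(1 - t) *\<^sub>R x + t *\<^sub>R y\<bar> ^ p \<le> (1 - t) * \<bar>x\<bar> ^ p + t * \<bar>y\<bar> ^ p" .
  qed simp
qed (simp add: convex_on_def)

text \<open>Jensen's inequality on each sphere, integrated against a radial weight.\<close>
lemma integrable_sph_avg_power:
  fixes H :: "'a::euclidean_space \<Rightarrow> real"
  assumes f [measurable]: "f \<in> borel_measurable borel" and f0: "\<And>r. 0 \<le> f r"
    and H [measurable]: "H \<in> borel_measurable borel"
    and int: "integrable unif_ball H" "integrable unif_ball (\<lambda>x. \<bar>H x\<bar> ^ p)"
      "integrable unif_ball (\<lambda>x. f (norm x) * \<bar>H x\<bar> ^ p)"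
  shows "integrable (unif_ball :: 'a measure) (\<lambda>x. f (norm x) * \<bar>sph_avg H (norm x)\<bar> ^ p)"
proof (rule Bochner_Integration.integrable_bound)
  show "integrable (unif_ball :: 'a measure) (\<lambda>x. f (norm x) * sph_avg (\<lambda>x. \<bar>H x\<bar> ^ p) (norm x))"
    by (rule sph_avg_mult(1)) (use int in auto)
  have ae: "AE x in unif_ball. integrable unif_ball (\<lambda>y. H (norm (x::'a) *\<^sub>R sgn y))"
    by (rule ubp.AE_integrable_fst) (rule integrable_polar(1)[OF int(1)])
  have ae2: "AE x in unif_ball. integrable unif_ball (\<lambda>y. \<bar>H (norm (x::'a) *\<^sub>R sgn y)\<bar> ^ p)"
    by (rule ubp.AE_integrable_fst) (rule integrable_polar(1)[OF int(2)])
  show "AE x in (unif_ball :: 'a measure). norm (f (norm x) * \<bar>sph_avg H (norm x)\<bar> ^ p)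
      \<le> norm (f (norm x) * sph_avg (\<lambda>x. \<bar>H x\<bar> ^ p) (norm x))"
    using ae ae2
  proof eventually_elim
    case (elim x)
    have "\<bar>sph_avg H (norm x)\<bar> ^ p \<le> sph_avg (\<lambda>x. \<bar>H x\<bar> ^ p) (norm x)"
      unfolding sph_avg_def
      by (rule ub.jensens_inequality[where I=UNIV]) (use elim convex_on_abs_power in auto)
    then have "f (norm x) * \<bar>sph_avg H (norm x)\<bar> ^ p \<le> f (norm x) * sph_avg (\<lambda>x. \<bar>H x\<bar> ^ p) (norm x)"
      by (rule mult_left_mono) (rule f0)
    moreover have "0 \<le> f (norm x) * \<bar>sph_avg H (norm x)\<bar> ^ p"
      using f0 by simp
    ultimately show ?case
      by simp
  qed
qed measurable

section \<open>The distribution of the norm\<close>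

text \<open>The derivative on $(0,1)$ of $r^n$, the probability of norm below $r$.\<close>
definition norm_density :: "nat \<Rightarrow> real \<Rightarrow> real"
  where "norm_density n r = indicator {0<..<1} r * (real n * r ^ (n - 1))"

lemma norm_density_nonneg: "0 \<le> norm_density n r"
  by (auto simp: norm_density_def indicator_def)

lemma borel_measurable_norm_density [measurable]: "norm_density n \<in> borel_measurable borel"
  unfolding norm_density_def[abs_def] by measurable

lemma distr_norm_unif_ball:
  "distr (unif_ball :: 'a::euclidean_space measure) borel norm = density lborel (norm_density DIM('a))"
proof (rule measure_eqI_lessThan)
  let ?n = "DIM('a)" and ?M = "distr (unif_ball :: 'a::euclidean_space measure) borel norm"
  have M: "emeasure ?M {r<..} = ub.prob {x::'a. r < norm x}" for r
    by (simp add: emeasure_distr vimage_def ub.emeasure_eq_measure)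
  show "emeasure ?M {r<..} < \<infinity>" for r
    by (simp add: M)
  have N: "emeasure (density lborel (norm_density ?n)) {r<..} = 1 - r ^ ?n" if "0 \<le> r" "r \<le> 1" for r
  proof -
    have "emeasure (density lborel (norm_density ?n)) {r<..} =
        (\<integral>\<^sup>+x. ennreal (norm_density ?n x) * indicator {r<..} x \<partial>lborel)"
      by (simp add: emeasure_density)
    also have "\<dots> = (\<integral>\<^sup>+x. ennreal (real ?n * x ^ (?n - 1)) * indicator {r..1} x \<partial>lborel)"
    proof (rule nn_integral_cong_AE)
      show "AE x in lborel. ennreal (norm_density ?n x) * indicator {r<..} x =
          ennreal (real ?n * x ^ (?n - 1)) * indicator {r..1} x"
        using AE_lborel_singleton[of r] AE_lborel_singleton[of "1::real"]
        by eventually_elim (use that in \<open>auto simp: norm_density_def indicator_def\<close>)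
    qed
    also have "\<dots> = 1 ^ ?n - r ^ ?n"
      by (rule nn_integral_FTC_Icc) (use that in \<open>auto intro!: derivative_eq_intros\<close>)
    finally show ?thesis by simp
  qed
  show "emeasure ?M {r<..} = emeasure (density lborel (norm_density ?n)) {r<..}" for r
  proof -
    consider "r \<le> 0" | "0 < r" "r \<le> 1" | "1 < r" by linarith
    then show ?thesis
    proof cases
      case 1
      have "ub.prob {x::'a. r < norm x} = ub.prob (UNIV :: 'a set)"
        by (intro ub.finite_measure_eq_AE eventually_mono[OF AE_unif_ball_norm])
          (use 1 in \<open>auto intro: le_less_trans\<close>)
      then have "emeasure ?M {r<..} = 1"
        using ub.prob_space[where ?'a='a] by (simp add: M)
      also have "1 = emeasure (density lborel (norm_density ?n)) {0<..}"
        using N[of 0] by simp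
      also have "\<dots> = emeasure (density lborel (norm_density ?n)) {r<..}"
        using 1 by (auto simp: emeasure_density norm_density_def indicator_def intro!: nn_integral_cong)
      finally show ?thesis .
    next
      case 2
      then show ?thesis
        using prob_norm_greater[of r, where ?'a='a] by (simp add: M N)
    next
      case 3
      have "ub.prob {x::'a. r < norm x} = ub.prob ({} :: 'a set)"
        by (intro ub.finite_measure_eq_AE eventually_mono[OF AE_unif_ball_norm]) (use 3 in auto)
      moreover have "emeasure (density lborel (norm_density ?n)) {r<..} = 0"
        using 3 by (auto simp: emeasure_density norm_density_def indicator_def nn_integral_0_iff_AE)
      ultimately show ?thesis
        by (simp add: M)
    qed
  qed
qed simp_all

lemma AE_unif_ball_norm_if:
  assumes "AE r in lborel. 0 < r \<longrightarrow> r < 1 \<longrightarrow> P r"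
  shows "AE x in (unif_ball :: 'a::euclidean_space measure). P (norm x)"
proof -
  have "AE r in distr (unif_ball :: 'a measure) borel norm. P r"
    unfolding distr_norm_unif_ball using assms
    by (subst AE_density) (auto simp: norm_density_def indicator_def elim!: eventually_mono split: if_splits)
  then show ?thesis
    by (rule AE_distrD[rotated]) simp
qed

text \<open>The converse transfer, from the ball to the radial variable, uses that the density is
  positive on $(0,1)$.\<close>
lemma AE_unif_ball_norm_only_if:
  assumes [measurable]: "Measurable.pred borel P"
    and "AE x in (unif_ball :: 'a::euclidean_space measure). P (norm x)"
  shows "AE r in lborel. 0 < r \<longrightarrow> r < 1 \<longrightarrow> P r"
proof -
  have "AE r in distr (unif_ball :: 'a measure) borel norm. P r"
    using assms(2) by (subst AE_distr_iff) auto
  then have "AE r in lborel. 0 < norm_density DIM('a) r \<longrightarrow> P r"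
    unfolding distr_norm_unif_ball by (subst (asm) AE_density) auto
  then show ?thesis
    by eventually_elim (auto simp: norm_density_def)
qed

lemma unif_ball_integral_norm:
  fixes f :: "real \<Rightarrow> real"
  assumes [measurable]: "f \<in> borel_measurable borel"
  shows "integrable (unif_ball :: 'a::euclidean_space measure) (\<lambda>x. f (norm x)) \<longleftrightarrow>
      integrable lborel (\<lambda>r. norm_density DIM('a) r * f r)"
    and "(\<integral>x. f (norm x) \<partial>(unif_ball :: 'a measure)) = (\<integral>r. norm_density DIM('a) r * f r \<partial>lborel)"
proof -
  have "integrable (unif_ball :: 'a::euclidean_space measure) (\<lambda>x. f (norm x)) \<longleftrightarrow>
      integrable (distr (unif_ball :: 'a measure) borel norm) f"
    by (rule integrable_distr_eq[symmetric]) auto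
  also have "\<dots> \<longleftrightarrow> integrable lborel (\<lambda>r. norm_density DIM('a) r * f r)"
    unfolding distr_norm_unif_ball
    by (subst integrable_density) (auto simp: norm_density_nonneg)
  finally show "integrable (unif_ball :: 'a::euclidean_space measure) (\<lambda>x. f (norm x)) \<longleftrightarrow>
      integrable lborel (\<lambda>r. norm_density DIM('a) r * f r)" .
  have "(\<integral>x. f (norm x) \<partial>(unif_ball :: 'a measure)) =
      integral\<^sup>L (distr (unif_ball :: 'a measure) borel norm) f"
    by (rule integral_distr[symmetric]) auto
  also have "\<dots> = (\<integral>r. norm_density DIM('a) r * f r \<partial>lborel)"
    unfolding distr_norm_unif_ball
    by (subst integral_density) (auto simp: norm_density_nonneg)
  finally show "(\<integral>x. f (norm x) \<partial>(unif_ball :: 'a measure)) = (\<integral>r. norm_density DIM('a) r * f r \<partial>lborel)" .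
qed

section \<open>Lebesgue measurable functions and their Borel representatives\<close>

text \<open>Products and compositions with the norm need Borel functions, whereas Sobolev functions
  are only Lebesgue measurable.  Passing to a Borel representative changes no integral.\<close>
lemma lebesgue_on_representative:
  fixes f f' :: "'a::euclidean_space \<Rightarrow> real"
  assumes S [measurable]: "S \<in> sets borel" and f' [measurable]: "f' \<in> borel_measurable borel"
    and ae: "AE x in lborel. x \<in> S \<longrightarrow> f x = f' x"
  shows "f \<in> borel_measurable (lebesgue_on S)"
    and "integrable (lebesgue_on S) f \<longleftrightarrow> integrable lborel (\<lambda>x. indicator S x * f' x)"
    and "integral\<^sup>L (lebesgue_on S) f = (\<integral>x. indicator S x * f' x \<partial>lborel)"
proof -
  have ae': "AE x in lebesgue. indicator S x * f' x = indicator S x * f x"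
    by (rule AE_completion, use ae in eventually_elim) (auto simp: indicator_def)
  have m': "(\<lambda>x. indicator S x * f' x) \<in> borel_measurable lebesgue"
    by (rule measurable_completion) measurable
  have m: "(\<lambda>x. indicator S x * f x) \<in> borel_measurable lebesgue"
    by (rule borel_measurable_AE[OF m' ae'])
  have S': "S \<inter> space lebesgue \<in> sets lebesgue"
    using S by simp
  show "f \<in> borel_measurable (lebesgue_on S)"
    using m by (simp add: borel_measurable_restrict_space_iff S')
  have "integrable (lebesgue_on S) f \<longleftrightarrow> integrable lebesgue (\<lambda>x. indicator S x * f x)"
    by (simp add: integrable_restrict_space S')
  also have "\<dots> \<longleftrightarrow> integrable lebesgue (\<lambda>x. indicator S x * f' x)"
    using ae' by (intro integrable_cong_AE m m') auto
  also have "\<dots> \<longleftrightarrow> integrable lborel (\<lambda>x. indicator S x * f' x)"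
    by (rule integrable_completion) measurable
  finally show "integrable (lebesgue_on S) f \<longleftrightarrow> integrable lborel (\<lambda>x. indicator S x * f' x)" .
  have "integral\<^sup>L (lebesgue_on S) f = (\<integral>x. indicator S x * f x \<partial>lebesgue)"
    by (simp add: integral_restrict_space S')
  also have "\<dots> = (\<integral>x. indicator S x * f' x \<partial>lebesgue)"
    using ae' by (intro integral_cong_AE m m') auto
  also have "\<dots> = (\<integral>x. indicator S x * f' x \<partial>lborel)"
    by (rule integral_completion) measurable
  finally show "integral\<^sup>L (lebesgue_on S) f = (\<integral>x. indicator S x * f' x \<partial>lborel)" .
qed

lemma obtain_borel_representative:
  fixes f :: "'a::euclidean_space \<Rightarrow> real"
  assumes "f \<in> borel_measurable (lebesgue_on S)" and S: "S \<in> sets borel"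
  obtains f' where "f' \<in> borel_measurable borel" "AE x in lborel. x \<in> S \<longrightarrow> f x = f' x"
proof -
  have "(\<lambda>x. indicator S x * f x) \<in> borel_measurable (completion lborel)"
    using assms by (simp add: borel_measurable_restrict_space_iff)
  from completion_ex_borel_measurable_real[OF this]
  obtain f' where f': "f' \<in> borel_measurable lborel" "AE x in lborel. indicator S x * f x = f' x"
    by auto
  show thesis
    by (rule that[of f'], use f' in simp, use f'(2) in eventually_elim) (auto simp: indicator_def)
qed

lemma AE_lebesgue_on_iff:
  fixes S :: "'a::euclidean_space set"
  assumes "S \<in> sets borel"
  shows "(AE x in lebesgue_on S. P x) \<longleftrightarrow> (AE x in lborel. x \<in> S \<longrightarrow> P x)"
  using assms by (simp add: AE_restrict_space_iff AE_completion_iff)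

text \<open>An open set is a countable union of compact sets, on each of which $f$ is measurable.\<close>
lemma locally_integrable_on_measurable:
  fixes f :: "'a::euclidean_space \<Rightarrow> 'b::euclidean_space"
  assumes f: "locally_integrable_on f U" and U: "open U"
  shows "f \<in> borel_measurable (lebesgue_on U)"
proof -
  obtain C where C: "\<And>n. compact (C n)" "\<And>n. C n \<subseteq> U" "\<And>n. C n \<subseteq> interior (C (Suc n))"
      "\<Union>(range C) = U"
    and N: "\<And>K. compact K \<Longrightarrow> K \<subseteq> U \<Longrightarrow> \<exists>N. \<forall>n\<ge>N. K \<subseteq> C n"
    by (rule open_Union_compact_subsets[OF U]) blast
  have CS: "C n \<in> sets lebesgue" for n
    using C(1) by (simp add: compact_imp_closed borel_closed)
  have "(\<lambda>x. indicator U x *\<^sub>R f x) \<in> borel_measurable lebesgue"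
  proof (rule borel_measurable_LIMSEQ_metric)
    show "(\<lambda>x. indicator (C n) x *\<^sub>R f x) \<in> borel_measurable lebesgue" for n
    proof -
      have "f \<in> borel_measurable (lebesgue_on (C n))"
        using f C unfolding locally_integrable_on_def by (auto intro: borel_measurable_integrable)
      then show ?thesis
        using CS by (simp add: borel_measurable_restrict_space_iff)
    qed
    show "(\<lambda>n. indicator (C n) x *\<^sub>R f x) \<longlonglongrightarrow> indicator U x *\<^sub>R f x" for x
    proof (cases "x \<in> U")
      case True
      obtain N where "\<forall>n\<ge>N. {x} \<subseteq> C n"
        using N[of "{x}"] True by auto
      then have "\<forall>\<^sub>F n in sequentially. indicator (C n) x *\<^sub>R f x = indicator U x *\<^sub>R f x"
        using True by (auto simp: eventually_sequentially intro!: exI[of _ N])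
      then show ?thesis
        by (rule tendsto_eventually)
    next
      case False
      then have "indicator (C n) x *\<^sub>R f x = indicator U x *\<^sub>R f x" for n
        using C(2)[of n] by (auto simp: indicator_def)
      then show ?thesis
        by (simp only: tendsto_const)
    qed
  qed
  then show ?thesis
    using U by (simp add: borel_measurable_restrict_space_iff borel_open)
qed

section \<open>Test functions\<close>

lemma GDERIV_unique:
  assumes "GDERIV f x :> D" "GDERIV f x :> E"
  shows "D = E"
proof -
  have "(\<lambda>h. h \<bullet> D) = (\<lambda>h. h \<bullet> E)"
    using assms unfolding gderiv_def by (rule has_derivative_unique)
  then have "(D - E) \<bullet> D = (D - E) \<bullet> E"
    by (rule fun_cong)
  then have "(D - E) \<bullet> (D - E) = 0"
    by (simp add: inner_diff_right)
  then show ?thesis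
    by simp
qed

lemma grad_eq:
  assumes "GDERIV f x :> D"
  shows "grad f x = D"
  unfolding grad_def using assms GDERIV_unique by (intro the_equality) auto

lemma GDERIV_transform_open:
  assumes "GDERIV f x :> D" "open U" "x \<in> U" "\<And>y. y \<in> U \<Longrightarrow> f y = g y"
  shows "GDERIV g x :> D"
  using assms has_derivative_transform_within_open[of f _ x UNIV U g] unfolding gderiv_def by auto

lemma C1_compact_supportI:
  fixes f :: "'a::euclidean_space \<Rightarrow> real"
  assumes G: "\<And>x. GDERIV f x :> G x" and cont: "continuous_on UNIV G"
    and K: "compact K" "K \<subseteq> U" "\<And>x. x \<notin> K \<Longrightarrow> f x = 0"
  shows "f \<in> C1_compact_support U" and "grad f = G"
proof -
  show eq: "grad f = G"
    using grad_eq[OF G] by (rule ext)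
  have sub: "closure {x. f x \<noteq> 0} \<subseteq> K"
    using K by (intro closure_minimal compact_imp_closed) auto
  moreover have "compact (closure {x. f x \<noteq> 0})"
    by (rule compact_closure[THEN iffD2], rule bounded_subset[OF compact_imp_bounded[OF K(1)]]) (use K(3) in auto)
  ultimately show "f \<in> C1_compact_support U"
    using G cont K(2) by (auto simp: C1_compact_support_def eq)
qed

lemma C1_compact_supportE:
  fixes f :: "'a::euclidean_space \<Rightarrow> real"
  assumes f: "f \<in> C1_compact_support U"
  obtains K M where "compact K" "K \<subseteq> U" "\<And>x. x \<notin> K \<Longrightarrow> f x = 0" "\<And>x. x \<notin> K \<Longrightarrow> grad f x = 0"
    "0 \<le> M" "\<And>x. \<bar>f x\<bar> \<le> M" "\<And>x. norm (grad f x) \<le> M"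
proof -
  define K where "K = closure {x. f x \<noteq> 0}"
  have G: "\<And>x. GDERIV f x :> grad f x" and cont: "continuous_on UNIV (grad f)" and K: "compact K" "K \<subseteq> U"
    using f by (auto simp: C1_compact_support_def K_def)
  have out: "f x = 0" if "x \<notin> K" for x
    using that closure_subset[of "{x. f x \<noteq> 0}"] unfolding K_def by blast
  have out': "grad f x = 0" if "x \<notin> K" for x
  proof (rule grad_eq, rule GDERIV_transform_open)
    show "GDERIV (\<lambda>_. 0) x :> 0"
      by (rule GDERIV_const)
    show "open (- K)"
      using K(1) by (simp add: compact_imp_closed open_Compl)
    show "x \<in> - K"
      using that by auto
    show "0 = f y" if "y \<in> - K" for y
      using out that by simp
  qed
  have contf: "continuous_on UNIV f"
    using G unfolding gderiv_def by (intro continuous_at_imp_continuous_on ballI has_derivative_continuous)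
  have "bounded (f ` K)" "bounded (grad f ` K)"
    using compact_imp_bounded[OF compact_continuous_image[OF continuous_on_subset[OF contf] K(1)]]
      compact_imp_bounded[OF compact_continuous_image[OF continuous_on_subset[OF cont] K(1)]] by blast+
  then obtain M1 M2 where M: "\<And>x. x \<in> K \<Longrightarrow> norm (f x) \<le> M1" "\<And>x. x \<in> K \<Longrightarrow> norm (grad f x) \<le> M2"
    by (auto simp: bounded_iff)
  show thesis
  proof (rule that[OF K out out'])
    show "0 \<le> max 0 (max M1 M2)"
      by simp
    show "\<bar>f x\<bar> \<le> max 0 (max M1 M2)" for x
      using M(1)[of x] out[of x] by (cases "x \<in> K") auto
    show "norm (grad f x) \<le> max 0 (max M1 M2)" for x
      using M(2)[of x] out'[of x] by (cases "x \<in> K") auto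
  qed
qed

lemma C1_compact_support_continuous:
  fixes f :: "'a::euclidean_space \<Rightarrow> real"
  assumes f: "f \<in> C1_compact_support U"
  shows "GDERIV f x :> grad f x" "continuous_on UNIV f" "continuous_on UNIV (grad f)"
proof -
  show G: "GDERIV f x :> grad f x" for x
    using f by (simp add: C1_compact_support_def)
  show "continuous_on UNIV f"
    using G unfolding gderiv_def by (intro continuous_at_imp_continuous_on ballI has_derivative_continuous)
  show "continuous_on UNIV (grad f)"
    using f by (simp add: C1_compact_support_def)
qed

lemma C1_compact_support_borel:
  fixes f :: "'a::euclidean_space \<Rightarrow> real"
  assumes f: "f \<in> C1_compact_support U"
  shows "f \<in> borel_measurable borel" "grad f \<in> borel_measurable borel"
  by (intro borel_measurable_continuous_onI C1_compact_support_continuous[OF f])+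

lemma compact_subset_ball:
  fixes K :: "'a::euclidean_space set"
  assumes "compact K" "K \<subseteq> ball 0 1"
  obtains \<rho> where "0 \<le> \<rho>" "\<rho> < 1" "K \<subseteq> cball 0 \<rho>"
proof (cases "K = {}")
  case True
  then show thesis
    using that[of 0] by auto
next
  case False
  then obtain y where "y \<in> K" "\<forall>x\<in>K. norm x \<le> norm y"
    using continuous_attains_sup[OF assms(1), of norm] by (auto intro: continuous_intros)
  moreover from this have "norm y < 1" "K \<subseteq> cball 0 (norm y)"
    using assms(2) by auto
  ultimately show thesis
    using that[of "norm y"] by simp
qed

text \<open>At the origin the norm is not differentiable; there the vanishing of the derivative of the
  profile makes the gradient exist and equal 0.\<close>
lemma GDERIV_radial:
  fixes \<psi> :: "real \<Rightarrow> real" and x :: "'a::euclidean_space"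
  assumes deriv: "\<And>r. (\<psi> has_real_derivative \<psi>' r) (at r)" and zero: "\<psi>' 0 = 0"
  shows "GDERIV (\<lambda>x. \<psi> (norm x)) x :> \<psi>' (norm x) *\<^sub>R sgn x"
proof (cases "x = 0")
  case False
  then show ?thesis
    by (intro GDERIV_DERIV_compose[OF GDERIV_norm] deriv)
next
  case True
  have "((\<lambda>r. (\<psi> r - \<psi> 0) / r) \<longlongrightarrow> 0) (at 0)"
    using deriv[of 0] by (simp add: has_field_derivative_iff zero)
  then have "((\<lambda>r. \<bar>(\<psi> r - \<psi> 0) / r\<bar>) \<longlongrightarrow> 0) (at 0)"
    by (rule tendsto_rabs_zero)
  moreover have "filterlim norm (at 0) (at (0::'a))"
    by (auto simp: filterlim_at eventually_at_filter tendsto_norm_zero)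
  ultimately have "((\<lambda>h::'a. \<bar>(\<psi> (norm h) - \<psi> 0) / norm h\<bar>) \<longlongrightarrow> 0) (at 0)"
    by (rule filterlim_compose)
  then have "((\<lambda>x::'a. \<psi> (norm x)) has_derivative (\<lambda>h. 0)) (at 0)"
    by (simp add: has_derivative_at abs_divide)
  then show ?thesis
    by (simp add: gderiv_def True)
qed

lemma continuous_on_radial_gradient:
  fixes \<psi>' :: "real \<Rightarrow> real"
  assumes cont: "continuous_on UNIV \<psi>'" and zero: "\<psi>' 0 = 0"
  shows "continuous_on UNIV (\<lambda>x::'a::euclidean_space. \<psi>' (norm x) *\<^sub>R sgn x)"
proof (rule continuous_at_imp_continuous_on, rule ballI)
  fix x :: 'a
  have c: "isCont (\<lambda>x::'a. \<psi>' (norm x)) y" for y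
    using cont by (intro continuous_at_compose[of y norm \<psi>', unfolded o_def] continuous_intros)
      (auto simp: continuous_on_eq_continuous_at)
  show "isCont (\<lambda>x::'a. \<psi>' (norm x) *\<^sub>R sgn x) x"
  proof (cases "x = 0")
    case False
    then show ?thesis
      using c by (intro continuous_intros) auto
  next
    case True
    have "((\<lambda>x::'a. \<psi>' (norm x)) \<longlongrightarrow> 0) (at 0)"
      using c[of 0] by (simp add: isCont_def zero)
    then have "((\<lambda>x::'a. \<bar>\<psi>' (norm x)\<bar>) \<longlongrightarrow> 0) (at 0)"
      by (rule tendsto_rabs_zero)
    then have "((\<lambda>x::'a. \<psi>' (norm x) *\<^sub>R sgn x) \<longlongrightarrow> 0) (at 0)"
      by (rule Lim_null_comparison[rotated]) (auto simp: norm_sgn intro!: always_eventually)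
    then show ?thesis
      by (simp add: True isCont_def)
  qed
qed

section \<open>Uniqueness of weak derivatives on an interval\<close>

lemma has_real_derivative_max_square:
  "((\<lambda>t::real. (max 0 t)\<^sup>2) has_real_derivative 2 * max 0 t) (at t)"
proof (rule linorder_cases[of t 0])
  assume "t < 0"
  have "((\<lambda>t. 0) has_real_derivative 0) (at t)"
    by simp
  then have "((\<lambda>t::real. (max 0 t)\<^sup>2) has_real_derivative 0) (at t)"
    by (rule has_field_derivative_transform_within_open[where S="{..<0}"]) (use \<open>t < 0\<close> in auto)
  then show ?thesis
    using \<open>t < 0\<close> by simp
next
  assume "0 < t"
  have "((\<lambda>t::real. t\<^sup>2) has_real_derivative 2 * t) (at t)"
    by (auto intro!: derivative_eq_intros)
  then have "((\<lambda>t::real. (max 0 t)\<^sup>2) has_real_derivative 2 * t) (at t)"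
    by (rule has_field_derivative_transform_within_open[where S="{0<..}"]) (use \<open>0 < t\<close> in auto)
  then show ?thesis
    using \<open>0 < t\<close> by simp
next
  assume t: "t = 0"
  have "((\<lambda>h::real. (max 0 h)\<^sup>2 / h) \<longlongrightarrow> 0) (at 0)"
  proof (rule Lim_null_comparison)
    show "\<forall>\<^sub>F h::real in at 0. norm ((max 0 h)\<^sup>2 / h) \<le> \<bar>h\<bar>"
      by (auto simp: max_def power2_eq_square intro!: always_eventually)
    show "((\<lambda>h::real. \<bar>h\<bar>) \<longlongrightarrow> 0) (at 0)"
      by (rule tendsto_rabs_zero) simp
  qed
  then show ?thesis
    by (simp add: t has_field_derivative_iff)
qed

text \<open>With the $C^1$ function $s = \max(0, (x-a)(b-x))^2$, which is positive exactly on $(a,b)$,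
  the functions $m s / (1 + m s)$ increase to the indicator of $(a,b)$ and stay below 1.\<close>
lemma indicator_approximation:
  fixes a b :: real
  assumes ab: "a < b" and U: "{a..b} \<subseteq> U"
  obtains \<phi> :: "nat \<Rightarrow> real \<Rightarrow> real" where "\<And>m. \<phi> m \<in> C1_compact_support U"
    "\<And>m x. 0 \<le> \<phi> m x" "\<And>m x. \<phi> m x \<le> indicator {a..b} x"
    "\<And>x. (\<lambda>m. \<phi> m x) \<longlonglongrightarrow> indicator {a<..<b} x"
proof -
  define s s' where "s x = (max 0 ((x - a) * (b - x)))\<^sup>2"
    and "s' x = 2 * max 0 ((x - a) * (b - x)) * (a + b - 2 * x)" for x
  define \<phi> where "\<phi> m x = real m * s x / (1 + real m * s x)" for m x
  define \<phi>' where "\<phi>' m x = real m * s' x / (1 + real m * s x)\<^sup>2" for m x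
  have s0: "0 \<le> s x" for x
    by (simp add: s_def)
  have den: "0 < 1 + real m * s x" for m x
    using s0[of x] by (intro add_pos_nonneg mult_nonneg_nonneg) auto
  have out: "s x = 0" if "x \<notin> {a<..<b}" for x
  proof -
    have "(x - a) * (b - x) \<le> 0"
      using that ab by (cases "x \<le> a") (auto intro: mult_nonpos_nonneg mult_nonneg_nonpos)
    then show ?thesis
      by (simp add: s_def max_def)
  qed
  have ds: "(s has_real_derivative s' x) (at x)" for x
    unfolding s_def[abs_def]
    by (rule DERIV_cong[OF DERIV_chain2[OF has_real_derivative_max_square]])
      (auto intro!: derivative_eq_intros simp: s'_def algebra_simps)
  have d: "(\<phi> m has_real_derivative \<phi>' m x) (at x)" for m x
    unfolding \<phi>_def[abs_def] using den[of m x]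
    by (auto intro!: derivative_eq_intros ds simp: \<phi>'_def field_simps power2_eq_square)
  have cs: "continuous_on UNIV s" "continuous_on UNIV s'"
    unfolding s_def[abs_def] s'_def[abs_def] by (intro continuous_intros)+
  have c: "continuous_on UNIV (\<phi>' m)" for m
    unfolding \<phi>'_def[abs_def] using den[of m]
    by (intro continuous_intros cs) (metis less_irrefl zero_eq_power2)
  show thesis
  proof (rule that)
    show "\<phi> m \<in> C1_compact_support U" for m
      by (rule C1_compact_supportI(1)[of _ "\<phi>' m" "{a..b}"]) (use d c U in \<open>auto simp: \<phi>_def out\<close>)
    show "0 \<le> \<phi> m x" for m x
      using s0[of x] den[of m x] by (simp add: \<phi>_def)
    show "\<phi> m x \<le> indicator {a..b} x" for m x
      using den[of m x] out[of x] by (auto simp: \<phi>_def indicator_def)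
    show "(\<lambda>m. \<phi> m x) \<longlonglongrightarrow> indicator {a<..<b} x" for x
    proof (cases "x \<in> {a<..<b}")
      case True
      then have sx: "0 < s x"
        by (simp add: s_def)
      have "(\<lambda>m. 1 - inverse (1 + real m * s x)) \<longlonglongrightarrow> 1 - 0"
      proof (intro tendsto_intros tendsto_inverse_0_at_top)
        have "filterlim (\<lambda>m. real m * s x) at_top sequentially"
          using sx by (intro filterlim_at_top_mult_tendsto_pos[OF tendsto_const] filterlim_real_sequentially)
        then show "filterlim (\<lambda>m. 1 + real m * s x) at_top sequentially"
          by (rule filterlim_tendsto_add_at_top[OF tendsto_const])
      qed
      moreover have "1 - inverse (1 + real m * s x) = \<phi> m x" for m
        using den[of m x] by (simp add: \<phi>_def field_simps)
      ultimately show ?thesis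
        using True by simp
    qed (simp add: \<phi>_def out)
  qed
qed

text \<open>The positive and the negative part of $F$ are densities of two finite measures that agree
  on all half-lines, hence they coincide almost everywhere.\<close>
lemma AE_zero_if_integral_Ioi_zero:
  fixes F :: "real \<Rightarrow> real"
  assumes F: "integrable lborel F" and zero: "\<And>x. (\<integral>t. indicator {x<..} t * F t \<partial>lborel) = 0"
  shows "AE t in lborel. F t = 0"
proof -
  have [measurable]: "F \<in> borel_measurable borel"
    using F by auto
  have fin: "integrable lborel (\<lambda>t. max 0 (F t))" "integrable lborel (\<lambda>t. max 0 (- F t))"
    using F by (auto intro: integrable_max)
  have em: "emeasure (density lborel (\<lambda>t. ennreal (max 0 (H t)))) {x<..} =
      ennreal (\<integral>t. indicator {x<..} t * max 0 (H t) \<partial>lborel)"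
    if "integrable lborel (\<lambda>t. max 0 (H t))" and [measurable]: "H \<in> borel_measurable borel" for H :: "real \<Rightarrow> real" and x
  proof -
    have "emeasure (density lborel (\<lambda>t. ennreal (max 0 (H t)))) {x<..} =
        (\<integral>\<^sup>+t. ennreal (indicator {x<..} t * max 0 (H t)) \<partial>lborel)"
      by (auto simp: emeasure_density indicator_def intro!: nn_integral_cong)
    also have "\<dots> = ennreal (\<integral>t. indicator {x<..} t * max 0 (H t) \<partial>lborel)"
      using integrable_mult_indicator[OF _ that(1), of "{x<..}"]
      by (intro nn_integral_eq_integral) (auto simp: indicator_def)
    finally show ?thesis .
  qed
  have eq: "(\<integral>t. indicator {x<..} t * max 0 (F t) \<partial>lborel) = (\<integral>t. indicator {x<..} t * max 0 (- F t) \<partial>lborel)" for x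
  proof -
    have "(\<integral>t. indicator {x<..} t * F t \<partial>lborel) =
        (\<integral>t. indicator {x<..} t * max 0 (F t) - indicator {x<..} t * max 0 (- F t) \<partial>lborel)"
      by (intro Bochner_Integration.integral_cong) (auto simp: max_def)
    also have "\<dots> = (\<integral>t. indicator {x<..} t * max 0 (F t) \<partial>lborel) - (\<integral>t. indicator {x<..} t * max 0 (- F t) \<partial>lborel)"
      using integrable_mult_indicator[OF _ fin(1), of "{x<..}"] integrable_mult_indicator[OF _ fin(2), of "{x<..}"]
      by (intro Bochner_Integration.integral_diff) auto
    finally show ?thesis
      by (simp add: zero)
  qed
  have "density lborel (\<lambda>t. ennreal (max 0 (F t))) = density lborel (\<lambda>t. ennreal (max 0 (- F t)))"
    by (rule measure_eqI_lessThan) (use fin in \<open>auto simp: em eq\<close>)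
  moreover have "(\<integral>\<^sup>+t. ennreal (max 0 (F t)) \<partial>lborel) \<noteq> \<infinity>"
    using fin(1) by (subst nn_integral_eq_integral) auto
  ultimately have "AE t in lborel. ennreal (max 0 (F t)) = ennreal (max 0 (- F t))"
    by (subst (asm) finite_density_unique) auto
  then show ?thesis
    by eventually_elim (auto simp: max_def split: if_splits)
qed

lemma integrable_mult_test_function:
  fixes w :: "'a::euclidean_space \<Rightarrow> real"
  assumes w: "locally_integrable_on w U" and U: "open U" and \<phi>: "\<phi> \<in> borel_measurable borel"
    and K: "compact K" "K \<subseteq> U" "\<And>x. x \<notin> K \<Longrightarrow> \<phi> x = 0" and M: "\<And>x. \<bar>\<phi> x\<bar> \<le> M"
  shows "integrable (lebesgue_on U) (\<lambda>x. w x * \<phi> x)"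
proof -
  have KU: "K \<in> sets lebesgue" "U \<in> sets lebesgue"
    using K U by (auto simp: compact_imp_closed borel_closed borel_open)
  have i: "integrable lebesgue (\<lambda>x. indicator K x * w x)"
  proof -
    have "integrable (lebesgue_on K) w"
      using w K(1,2) by (simp add: locally_integrable_on_def)
    then show ?thesis
      using KU by (simp add: integrable_restrict_space)
  qed
  have "integrable lebesgue (\<lambda>x. indicator K x * w x * \<phi> x)"
  proof (rule Bochner_Integration.integrable_bound)
    show "integrable lebesgue (\<lambda>x. M * (indicator K x * w x))"
      using i by simp
    show "(\<lambda>x. indicator K x * w x * \<phi> x) \<in> borel_measurable lebesgue"
      using borel_measurable_integrable[OF i] measurable_completion[of \<phi> lborel borel] \<phi> by auto
    show "AE x in lebesgue. norm (indicator K x * w x * \<phi> x) \<le> norm (M * (indicator K x * w x))"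
    proof (rule AE_I2)
      fix x
      have "\<bar>indicator K x * w x\<bar> * \<bar>\<phi> x\<bar> \<le> \<bar>indicator K x * w x\<bar> * \<bar>M\<bar>"
        using M[of x] by (intro mult_left_mono) auto
      then show "norm (indicator K x * w x * \<phi> x) \<le> norm (M * (indicator K x * w x))"
        by (simp add: abs_mult mult_ac)
    qed
  qed
  also have "(\<lambda>x. indicator K x * w x * \<phi> x) = (\<lambda>x. indicator U x *\<^sub>R (w x * \<phi> x))"
    using K by (auto simp: fun_eq_iff indicator_def)
  finally show ?thesis
    using KU by (simp add: integrable_restrict_space)
qed

text \<open>Approximating indicators by test functions shows that $d$ has integral 0 over every
  interval whose closure lies in $(p,q)$; this determines $d$ on each compact subinterval.\<close>
lemma fundamental_lemma_interval:
  fixes d :: "real \<Rightarrow> real"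
  assumes d: "locally_integrable_on d {p<..<q}"
    and zero: "\<And>\<phi>. \<phi> \<in> C1_compact_support {p<..<q} \<Longrightarrow> (LINT x|lebesgue_on {p<..<q}. d x * \<phi> x) = 0"
  shows "AE x in lborel. x \<in> {p<..<q} \<longrightarrow> d x = 0"
proof -
  let ?U = "{p<..<q}"
  have "d \<in> borel_measurable (lebesgue_on ?U)"
    by (rule locally_integrable_on_measurable[OF d]) simp
  then obtain D where D [measurable]: "D \<in> borel_measurable borel" and dD: "AE x in lborel. x \<in> ?U \<longrightarrow> d x = D x"
    by (rule obtain_borel_representative) auto
  have i: "integrable lborel (\<lambda>x. indicator {a..b} x * D x)" if "{a..b} \<subseteq> ?U" for a b
  proof -
    have "integrable (lebesgue_on {a..b}) d"
      using d that unfolding locally_integrable_on_def by auto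
    then show ?thesis
      by (subst (asm) lebesgue_on_representative(2)[of _ D]) (use dD that in \<open>auto elim!: eventually_mono\<close>)
  qed
  have int0: "(\<integral>x. indicator {a<..<b} x * D x \<partial>lborel) = 0" if ab: "a < b" "{a..b} \<subseteq> ?U" for a b
  proof -
    obtain \<phi> :: "nat \<Rightarrow> real \<Rightarrow> real" where \<phi>: "\<And>m. \<phi> m \<in> C1_compact_support ?U"
      "\<And>m x. 0 \<le> \<phi> m x" "\<And>m x. \<phi> m x \<le> indicator {a..b} x"
      "\<And>x. (\<lambda>m. \<phi> m x) \<longlonglongrightarrow> indicator {a<..<b} x"
      using indicator_approximation[OF ab] by metis
    note [measurable] = C1_compact_support_borel(1)[OF \<phi>(1)]
    have "(\<lambda>m. \<integral>x. \<phi> m x * D x \<partial>lborel) \<longlonglongrightarrow> (\<integral>x. indicator {a<..<b} x * D x \<partial>lborel)"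
    proof (rule integral_dominated_convergence[where w="\<lambda>x. \<bar>indicator {a..b} x * D x\<bar>"])
      show "integrable lborel (\<lambda>x. \<bar>indicator {a..b} x * D x\<bar>)"
        using i[OF ab(2)] by (rule integrable_abs)
      show "AE x in lborel. (\<lambda>m. \<phi> m x * D x) \<longlonglongrightarrow> indicator {a<..<b} x * D x"
        by (intro AE_I2 tendsto_mult \<phi>(4) tendsto_const)
      show "AE x in lborel. norm (\<phi> m x * D x) \<le> \<bar>indicator {a..b} x * D x\<bar>" for m
        using \<phi>(2,3) by (intro AE_I2) (auto simp: abs_mult intro!: mult_right_mono)
    qed auto
    moreover have "(\<integral>x. \<phi> m x * D x \<partial>lborel) = 0" for m
    proof -
      have out: "\<phi> m x = 0" if "x \<notin> {a..b}" for x
        using \<phi>(2,3)[of m x] that by simp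
      have "0 = (LINT x|lebesgue_on ?U. d x * \<phi> m x)"
        using zero[OF \<phi>(1)] by simp
      also have "\<dots> = (\<integral>x. indicator ?U x * (D x * \<phi> m x) \<partial>lborel)"
        by (rule lebesgue_on_representative(3)) (use dD in \<open>auto elim!: eventually_mono\<close>)
      also have "\<dots> = (\<integral>x. \<phi> m x * D x \<partial>lborel)"
      proof (intro Bochner_Integration.integral_cong refl)
        show "indicator ?U x * (D x * \<phi> m x) = \<phi> m x * D x" for x
          using out[of x] subsetD[OF ab(2), of x] by (cases "x \<in> {a..b}") auto
      qed
      finally show ?thesis
        by simp
    qed
    ultimately show ?thesis
      by (simp add: LIMSEQ_const_iff)
  qed
  have "AE x in lborel. indicator {a..b} x * D x = 0" if sub: "{a..b} \<subseteq> ?U" for a b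
  proof (rule AE_zero_if_integral_Ioi_zero[OF i[OF sub]])
    fix y
    have "(\<integral>x. indicator {y<..} x * (indicator {a..b} x * D x) \<partial>lborel) =
        (\<integral>x. indicator {max a y<..<b} x * D x \<partial>lborel)"
    proof (rule integral_cong_AE)
      show "AE x in lborel. indicator {y<..} x * (indicator {a..b} x * D x) = indicator {max a y<..<b} x * D x"
        using AE_lborel_singleton[of a] AE_lborel_singleton[of b]
        by eventually_elim (auto simp: indicator_def)
    qed measurable
    also have "\<dots> = 0"
    proof (cases "max a y < b")
      case True
      moreover have "{max a y..b} \<subseteq> ?U"
        by (rule order.trans[OF _ sub]) auto
      ultimately show ?thesis
        by (rule int0)
    qed auto
    finally show "(\<integral>x. indicator {y<..} x * (indicator {a..b} x * D x) \<partial>lborel) = 0" .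
  qed
  note ae = this
  have "AE x in lborel. \<forall>m::nat. indicator {p + inverse (real (Suc m))..q - inverse (real (Suc m))} x * D x = 0"
    unfolding AE_all_countable
  proof (intro allI ae subsetI)
    fix m :: nat and x
    assume x: "x \<in> {p + inverse (real (Suc m))..q - inverse (real (Suc m))}"
    have "0 < inverse (real (Suc m))"
      by simp
    then have "p < x \<and> x < q"
      using x unfolding atLeastAtMost_iff by linarith
    then show "x \<in> ?U"
      by simp
  qed
  then show ?thesis
    using dD
  proof eventually_elim
    case (elim x)
    show ?case
    proof
      assume x: "x \<in> ?U"
      then obtain m :: nat where "inverse (real (Suc m)) < min (x - p) (q - x)"
        using reals_Archimedean[of "min (x - p) (q - x)"] by auto
      then have "x \<in> {p + inverse (real (Suc m))..q - inverse (real (Suc m))}"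
        by auto
      then have "D x = 0"
        using elim(1) by (metis indicator_simps(1) mult_1)
      then show "d x = 0"
        using elim(2) x by simp
    qed
  qed
qed

text \<open>Needed because the radial derivative is an arbitrary choice among the weak derivatives of
  all profiles: any two of them agree almost everywhere.\<close>
lemma weak_derivative_unique:
  fixes v v' w w' :: "real \<Rightarrow> real"
  assumes w: "has_weak_gradient_on v w {p<..<q}" and w': "has_weak_gradient_on v' w' {p<..<q}"
    and v: "AE x in lborel. x \<in> {p<..<q} \<longrightarrow> v x = v' x"
  shows "AE x in lborel. x \<in> {p<..<q} \<longrightarrow> w x = w' x"
proof -
  let ?U = "{p<..<q}"
  have li: "locally_integrable_on v ?U" "locally_integrable_on w ?U" "locally_integrable_on v' ?U" "locally_integrable_on w' ?U"
    using w w' by (auto simp: has_weak_gradient_on_def)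
  have "AE x in lborel. x \<in> ?U \<longrightarrow> w x - w' x = 0"
  proof (rule fundamental_lemma_interval)
    show "locally_integrable_on (\<lambda>x. w x - w' x) ?U"
      using li unfolding locally_integrable_on_def by auto
    fix \<phi> assume \<phi>: "\<phi> \<in> C1_compact_support ?U"
    obtain K M where K: "compact K" "K \<subseteq> ?U" "\<And>x. x \<notin> K \<Longrightarrow> \<phi> x = 0" and M: "\<And>x. \<bar>\<phi> x\<bar> \<le> M"
      using C1_compact_supportE[OF \<phi>] by metis
    note int = integrable_mult_test_function[OF _ _ C1_compact_support_borel(1)[OF \<phi>] K M]
    have "(LINT x|lebesgue_on ?U. w x * \<phi> x) = - (LINT x|lebesgue_on ?U. v x * grad \<phi> x)"
      using w \<phi> by (auto simp: has_weak_gradient_on_def)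
    also have "(LINT x|lebesgue_on ?U. v x * grad \<phi> x) = (LINT x|lebesgue_on ?U. v' x * grad \<phi> x)"
    proof (rule integral_cong_AE)
      show "AE x in lebesgue_on ?U. v x * grad \<phi> x = v' x * grad \<phi> x"
        unfolding AE_lebesgue_on_iff[OF borel_open[OF open_greaterThanLessThan]] using v by eventually_elim auto
      have m: "grad \<phi> \<in> borel_measurable (lebesgue_on ?U)"
        using C1_compact_support_borel(2)[OF \<phi>]
        by (intro measurable_restrict_space1 measurable_completion) simp
      show "(\<lambda>x. v x * grad \<phi> x) \<in> borel_measurable (lebesgue_on ?U)"
        by (rule borel_measurable_times[OF locally_integrable_on_measurable[OF li(1)] m]) simp
      show "(\<lambda>x. v' x * grad \<phi> x) \<in> borel_measurable (lebesgue_on ?U)"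
        by (rule borel_measurable_times[OF locally_integrable_on_measurable[OF li(3)] m]) simp
    qed
    also have "- \<dots> = (LINT x|lebesgue_on ?U. w' x * \<phi> x)"
      using w' \<phi> by (auto simp: has_weak_gradient_on_def)
    finally show "(LINT x|lebesgue_on ?U. (w x - w' x) * \<phi> x) = 0"
      using int[OF li(2)] int[OF li(4)] by (simp add: left_diff_distrib)
  qed
  then show ?thesis
    by simp
qed

section \<open>Spherical means of test functions\<close>

text \<open>Symmetry of the ball, used to see that the mean direction vanishes.\<close>
lemma distr_unif_ball_uminus:
  "distr unif_ball borel uminus = (unif_ball :: 'a::euclidean_space measure)"
proof (rule measure_eqI)
  fix A :: "'a set" assume "A \<in> sets (distr unif_ball borel uminus)"
  then have [measurable]: "A \<in> sets borel"
    by simp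
  have m [measurable]: "uminus -` A \<in> sets (borel :: 'a measure)"
    by (rule measurable_sets_borel[of _ borel]) auto
  have "ball 0 1 \<inter> uminus -` A = (\<lambda>x. (-1) *\<^sub>R x + 0) ` (ball 0 1 \<inter> A)"
  proof (intro equalityI subsetI)
    fix x assume "x \<in> ball 0 1 \<inter> uminus -` A"
    then show "x \<in> (\<lambda>x. (-1) *\<^sub>R x + 0) ` (ball 0 1 \<inter> A)"
      by (intro image_eqI[where x = "- x"]) auto
  qed auto
  then have "emeasure lebesgue (ball 0 1 \<inter> uminus -` A) = emeasure lebesgue (ball 0 1 \<inter> A)"
    using emeasure_lebesgue_affine[of "-1" "0::'a" "ball 0 1 \<inter> A"] by simp
  then have "emeasure lborel (ball 0 1 \<inter> uminus -` A) = emeasure lborel (ball 0 1 \<inter> A)"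
    by simp
  then show "emeasure (distr unif_ball borel uminus) A = emeasure unif_ball A"
    by (simp add: emeasure_distr unif_ball_def)
qed simp

lemma integral_sgn_unif_ball: "(\<integral>y. sgn y \<bullet> c \<partial>(unif_ball :: 'a::euclidean_space measure)) = 0"
proof -
  have "(\<integral>y. sgn y \<bullet> c \<partial>(unif_ball :: 'a measure)) = (\<integral>y. sgn y \<bullet> c \<partial>distr unif_ball borel uminus)"
    by (simp add: distr_unif_ball_uminus)
  also have "\<dots> = (\<integral>y. sgn (- y) \<bullet> c \<partial>(unif_ball :: 'a measure))"
    by (rule integral_distr) auto
  also have "\<dots> = - (\<integral>y. sgn y \<bullet> c \<partial>(unif_ball :: 'a measure))"
    by (simp add: sgn_minus)
  finally show ?thesis
    by simp
qed

text \<open>The derivative of the spherical mean, obtained by differentiating $r \mapsto \eta(r\omega)$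
  for each direction.  It is defined for all real $r$, so that the spherical mean can be treated as a
  function on the whole line.\<close>
definition sph_avg_deriv :: "('a::euclidean_space \<Rightarrow> real) \<Rightarrow> real \<Rightarrow> real"
  where "sph_avg_deriv \<eta> r = (\<integral>y. sgn y \<bullet> grad \<eta> (r *\<^sub>R sgn y) \<partial>unif_ball)"

text \<open>On a sphere of positive radius the radial variable is the distance from the origin; for
  $r \le 0$ the direction of $r\omega$ is no longer $\omega$.\<close>
lemma sph_avg_deriv_eq:
  fixes \<eta> :: "'a::euclidean_space \<Rightarrow> real"
  assumes "0 < r"
  shows "sph_avg_deriv \<eta> r = sph_avg (\<lambda>x. sgn x \<bullet> grad \<eta> x) r"
proof -
  have "sgn (sgn y) = sgn y" for y :: 'a
    by (cases "y = 0") (simp_all add: sgn_div_norm)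
  then show ?thesis
    using assms by (simp add: sph_avg_deriv_def sph_avg_def sgn_scaleR)
qed

lemma test_function_lipschitz:
  fixes \<eta> :: "'a::euclidean_space \<Rightarrow> real"
  assumes \<eta>: "\<eta> \<in> C1_compact_support U" and M: "\<And>x. norm (grad \<eta> x) \<le> M"
  shows "\<bar>\<eta> x - \<eta> y\<bar> \<le> M * norm (x - y)"
proof -
  have "norm (\<eta> x - \<eta> y) \<le> M * norm (x - y)"
  proof (rule differentiable_bound[where S=UNIV and f'="\<lambda>x h. h \<bullet> grad \<eta> x"])
    show "(\<eta> has_derivative (\<lambda>h. h \<bullet> grad \<eta> x)) (at x within UNIV)" for x
      using C1_compact_support_continuous(1)[OF \<eta>] by (simp add: gderiv_def)
    show "onorm (\<lambda>h. h \<bullet> grad \<eta> x) \<le> M" for x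
    proof (rule onorm_bound)
      show "0 \<le> M"
        using M[of x] norm_ge_zero[of "grad \<eta> x"] by linarith
      show "norm (h \<bullet> grad \<eta> x) \<le> M * norm h" for h
        using Cauchy_Schwarz_ineq2[of h "grad \<eta> x"] mult_left_mono[OF M[of x], of "norm h"]
        by (simp add: mult.commute)
    qed
  qed auto
  then show ?thesis
    by simp
qed

lemma norm_scaleR_sgn_le: "norm (r *\<^sub>R sgn y) \<le> \<bar>r\<bar>"
  by (simp add: norm_sgn)

text \<open>Differentiation under the integral: the difference quotients are bounded by the Lipschitz
  constant of the test function.\<close>
lemma has_real_derivative_sph_avg:
  fixes \<eta> :: "'a::euclidean_space \<Rightarrow> real"
  assumes \<eta>: "\<eta> \<in> C1_compact_support U"
  shows "(sph_avg \<eta> has_real_derivative sph_avg_deriv \<eta> r) (at r)"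
proof -
  obtain M where M0: "0 \<le> M" and M: "\<And>x. \<bar>\<eta> x\<bar> \<le> M" "\<And>x. norm (grad \<eta> x) \<le> M"
    using C1_compact_supportE[OF \<eta>] by metis
  note [measurable] = C1_compact_support_borel[OF \<eta>]
  have int: "integrable unif_ball (\<lambda>y. \<eta> (s *\<^sub>R sgn y))" for s
    by (rule ub.integrable_const_bound[where B=M]) (use M in auto)
  have "((\<lambda>s. (sph_avg \<eta> s - sph_avg \<eta> r) / (s - r)) \<longlongrightarrow> sph_avg_deriv \<eta> r) (at r)"
    unfolding tendsto_at_iff_sequentially comp_def
  proof (intro allI impI)
    fix X :: "nat \<Rightarrow> real" assume X: "\<forall>i. X i \<in> UNIV - {r}" "X \<longlonglongrightarrow> r"
    have "(\<lambda>i. \<integral>y. (\<eta> (X i *\<^sub>R sgn y) - \<eta> (r *\<^sub>R sgn y)) / (X i - r) \<partial>unif_ball) \<longlonglongrightarrow>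
        sph_avg_deriv \<eta> r"
      unfolding sph_avg_deriv_def
    proof (rule integral_dominated_convergence[where w="\<lambda>_. M"])
      show "AE y in unif_ball. (\<lambda>i. (\<eta> (X i *\<^sub>R sgn y) - \<eta> (r *\<^sub>R sgn y)) / (X i - r)) \<longlonglongrightarrow>
          sgn y \<bullet> grad \<eta> (r *\<^sub>R sgn y)"
      proof (rule AE_I2)
        fix y :: 'a
        have "((\<lambda>s. \<eta> (s *\<^sub>R sgn y)) has_derivative (\<lambda>h. (h *\<^sub>R sgn y) \<bullet> grad \<eta> (r *\<^sub>R sgn y))) (at r)"
          by (rule has_derivative_compose[where g=\<eta>])
            (use C1_compact_support_continuous(1)[OF \<eta>, of "r *\<^sub>R sgn y"] in
              \<open>auto simp: gderiv_def intro!: derivative_eq_intros\<close>)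
        then have "((\<lambda>s. \<eta> (s *\<^sub>R sgn y)) has_real_derivative sgn y \<bullet> grad \<eta> (r *\<^sub>R sgn y)) (at r)"
          by (simp add: has_field_derivative_def mult_commute_abs)
        then show "(\<lambda>i. (\<eta> (X i *\<^sub>R sgn y) - \<eta> (r *\<^sub>R sgn y)) / (X i - r)) \<longlonglongrightarrow>
            sgn y \<bullet> grad \<eta> (r *\<^sub>R sgn y)"
          using X by (auto simp: has_field_derivative_iff tendsto_at_iff_sequentially comp_def)
      qed
      show "AE y in unif_ball. norm ((\<eta> (X i *\<^sub>R sgn y) - \<eta> (r *\<^sub>R sgn y)) / (X i - r)) \<le> M" for i
      proof (rule AE_I2)
        fix y :: 'a
        have "\<bar>\<eta> (X i *\<^sub>R sgn y) - \<eta> (r *\<^sub>R sgn y)\<bar> \<le> M * norm (X i *\<^sub>R sgn y - r *\<^sub>R sgn y)"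
          by (rule test_function_lipschitz[OF \<eta> M(2)])
        also have "\<dots> \<le> M * \<bar>X i - r\<bar>"
          using norm_scaleR_sgn_le[of "X i - r" y]
          by (intro mult_left_mono M0) (simp add: scaleR_diff_left)
        finally show "norm ((\<eta> (X i *\<^sub>R sgn y) - \<eta> (r *\<^sub>R sgn y)) / (X i - r)) \<le> M"
          using X(1)[rule_format, of i] by (simp add: divide_le_eq)
      qed
    qed auto
    moreover have "(\<integral>y. (\<eta> (X i *\<^sub>R sgn y) - \<eta> (r *\<^sub>R sgn y)) / (X i - r) \<partial>unif_ball) =
        (sph_avg \<eta> (X i) - sph_avg \<eta> r) / (X i - r)" for i
      using int by (simp add: sph_avg_def)
    ultimately show "(\<lambda>i. (sph_avg \<eta> (X i) - sph_avg \<eta> r) / (X i - r)) \<longlonglongrightarrow> sph_avg_deriv \<eta> r"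
      by (simp only:)
  qed
  then show ?thesis
    by (simp add: has_field_derivative_iff)
qed

lemma continuous_on_sph_avg_deriv:
  fixes \<eta> :: "'a::euclidean_space \<Rightarrow> real"
  assumes \<eta>: "\<eta> \<in> C1_compact_support U"
  shows "continuous_on UNIV (sph_avg_deriv \<eta>)"
proof (rule continuous_on_sequentiallyI)
  obtain M where M0: "0 \<le> M" and M: "\<And>x. norm (grad \<eta> x) \<le> M"
    using C1_compact_supportE[OF \<eta>] by metis
  note [measurable] = C1_compact_support_borel[OF \<eta>]
  fix X :: "nat \<Rightarrow> real" and r assume X: "X \<longlonglongrightarrow> r"
  show "(\<lambda>i. sph_avg_deriv \<eta> (X i)) \<longlonglongrightarrow> sph_avg_deriv \<eta> r"
    unfolding sph_avg_deriv_def
  proof (rule integral_dominated_convergence[where w="\<lambda>_. M"])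
    show "AE y in unif_ball. (\<lambda>i. sgn y \<bullet> grad \<eta> (X i *\<^sub>R sgn y)) \<longlonglongrightarrow> sgn y \<bullet> grad \<eta> (r *\<^sub>R sgn y)"
    proof (rule AE_I2)
      fix y :: 'a
      have "isCont (grad \<eta>) (r *\<^sub>R sgn y)"
        using C1_compact_support_continuous(3)[OF \<eta>] by (simp add: continuous_on_eq_continuous_at)
      then show "(\<lambda>i. sgn y \<bullet> grad \<eta> (X i *\<^sub>R sgn y)) \<longlonglongrightarrow> sgn y \<bullet> grad \<eta> (r *\<^sub>R sgn y)"
        using X by (intro tendsto_intros isCont_tendsto_compose[where g="grad \<eta>"])
    qed
    show "AE y in unif_ball. norm (sgn y \<bullet> grad \<eta> (X i *\<^sub>R sgn y)) \<le> M" for i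
    proof (rule AE_I2)
      fix y :: 'a
      have "norm (sgn y \<bullet> grad \<eta> (X i *\<^sub>R sgn y)) \<le> norm (sgn y) * norm (grad \<eta> (X i *\<^sub>R sgn y))"
        by (simp add: Cauchy_Schwarz_ineq2)
      also have "\<dots> \<le> 1 * M"
        using M M0 by (intro mult_mono) (auto simp: norm_sgn)
      finally show "norm (sgn y \<bullet> grad \<eta> (X i *\<^sub>R sgn y)) \<le> M"
        by simp
    qed
  qed auto
qed

text \<open>The radial test function attached to an arbitrary one.  The derivative of the spherical
  mean at 0 is the inner product of the gradient at the origin with the mean direction, hence 0, so no
  kink arises at the origin.\<close>
lemma radial_mean_test_function:
  fixes \<eta> :: "'a::euclidean_space \<Rightarrow> real"
  assumes \<eta>: "\<eta> \<in> C1_compact_support (ball 0 1)"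
  shows "(\<lambda>x::'a. sph_avg \<eta> (norm x)) \<in> C1_compact_support (ball 0 1)"
    and "grad (\<lambda>x::'a. sph_avg \<eta> (norm x)) = (\<lambda>x. sph_avg_deriv \<eta> (norm x) *\<^sub>R sgn x)"
proof -
  obtain K where "compact K" "K \<subseteq> ball 0 1" and out: "\<And>x. x \<notin> K \<Longrightarrow> \<eta> x = 0"
    using C1_compact_supportE[OF \<eta>] by metis
  then obtain \<rho> where \<rho>: "0 \<le> \<rho>" "\<rho> < 1" "K \<subseteq> cball 0 \<rho>"
    using compact_subset_ball by metis
  have zero: "sph_avg_deriv \<eta> 0 = 0"
    by (simp add: sph_avg_deriv_def integral_sgn_unif_ball)
  have G: "GDERIV (\<lambda>x::'a. sph_avg \<eta> (norm x)) x :> sph_avg_deriv \<eta> (norm x) *\<^sub>R sgn x" for x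
    by (rule GDERIV_radial[OF has_real_derivative_sph_avg[OF \<eta>] zero])
  have cont: "continuous_on UNIV (\<lambda>x::'a. sph_avg_deriv \<eta> (norm x) *\<^sub>R sgn x)"
    by (rule continuous_on_radial_gradient[OF continuous_on_sph_avg_deriv[OF \<eta>] zero])
  have sub: "cball 0 \<rho> \<subseteq> (ball 0 1 :: 'a set)"
    using \<rho> by auto
  have out': "sph_avg \<eta> (norm x) = 0" if "x \<notin> cball 0 \<rho>" for x :: 'a
  proof -
    have "sph_avg \<eta> (norm x) = (\<integral>y. 0 \<partial>(unif_ball :: 'a measure))"
      unfolding sph_avg_def
    proof (rule integral_cong_AE)
      show "AE y in unif_ball. \<eta> (norm x *\<^sub>R sgn y) = 0"
        using norm_scaleR_sgn_AE[of x]
      proof eventually_elim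
        case (elim y)
        then have "norm x *\<^sub>R sgn y \<notin> cball 0 \<rho>"
          using that unfolding mem_cball_0 by linarith
        then show ?case
          using \<rho>(3) out by blast
      qed
    qed (use C1_compact_support_borel(1)[OF \<eta>] in measurable)
    then show ?thesis
      by simp
  qed
  show "(\<lambda>x::'a. sph_avg \<eta> (norm x)) \<in> C1_compact_support (ball 0 1)"
    "grad (\<lambda>x::'a. sph_avg \<eta> (norm x)) = (\<lambda>x. sph_avg_deriv \<eta> (norm x) *\<^sub>R sgn x)"
    using C1_compact_supportI[OF G cont compact_cball sub out'] by auto
qed

section \<open>Weak derivatives of spherical means\<close>

text \<open>The uniform distribution is normalised Lebesgue measure, so integrability is the same and
  the integrals differ by the volume of the ball.\<close>
lemma lebesgue_on_unit_ball:
  fixes f f' :: "'a::euclidean_space \<Rightarrow> real"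
  assumes f' [measurable]: "f' \<in> borel_measurable borel" and ae: "AE x in unif_ball. f x = f' x"
  shows "integrable (lebesgue_on unit_ball) f \<longleftrightarrow> integrable unif_ball f'"
    and "integral\<^sup>L (lebesgue_on unit_ball) f = unit_ball_vol DIM('a) * integral\<^sup>L unif_ball f'"
proof -
  have [measurable]: "(unit_ball :: 'a set) \<in> sets borel"
    by simp
  define V where "V = unit_ball_vol DIM('a)"
  have V: "0 < V"
    by (simp add: V_def)
  have "emeasure lborel (ball (0::'a) 1) = ennreal V"
    by (simp add: emeasure_ball V_def)
  then have D: "unif_ball = density lborel (\<lambda>x::'a. ennreal (indicator (ball 0 1) x / V))"
    unfolding unif_ball_def uniform_measure_def using V
    by (intro density_cong) (auto simp: indicator_def divide_ennreal[of 1 V, simplified])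
  have ae': "AE x in lborel. x \<in> ball 0 1 \<longrightarrow> f x = f' x"
    using ae unfolding AE_unif_ball_iff by eventually_elim auto
  note R = lebesgue_on_representative[OF borel_open[OF open_ball] f' ae']
  have "integrable unif_ball f' \<longleftrightarrow> integrable lborel (\<lambda>x. indicator (ball 0 1) x / V * f' x)"
    unfolding D using V by (subst integrable_density) auto
  also have "\<dots> \<longleftrightarrow> integrable lborel (\<lambda>x. indicator (ball 0 1) x * f' x)"
    using V by (simp add: mult_ac divide_inverse)
  finally show "integrable (lebesgue_on unit_ball) f \<longleftrightarrow> integrable unif_ball f'"
    using R(2) by simp
  have "integral\<^sup>L unif_ball f' = (\<integral>x. indicator (ball 0 1) x / V * f' x \<partial>lborel)"
    unfolding D using V by (subst integral_density) auto
  also have "\<dots> = (\<integral>x. indicator (ball 0 1) x * f' x \<partial>lborel) / V"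
    by simp
  finally show "integral\<^sup>L (lebesgue_on unit_ball) f = V * integral\<^sup>L unif_ball f'"
    using R(3) V by simp
qed

lemma has_bochner_integral_unit_ball_zero_iff:
  fixes f f' :: "'a::euclidean_space \<Rightarrow> real"
  assumes "f' \<in> borel_measurable borel" "AE x in unif_ball. f x = f' x"
  shows "has_bochner_integral (lebesgue_on unit_ball) f 0 \<longleftrightarrow> has_bochner_integral unif_ball f' 0"
  by (simp add: has_bochner_integral_iff lebesgue_on_unit_ball[OF assms]
      less_imp_neq[OF unit_ball_vol_pos, symmetric])

text \<open>On a compact subset of $(0,1)$ the radial density is bounded below by a positive constant,
  so integrability over the ball passes to the radial variable.\<close>
lemma locally_integrable_sph_avg:
  fixes H :: "'a::euclidean_space \<Rightarrow> real"
  assumes H [measurable]: "H \<in> borel_measurable borel" and int: "integrable unif_ball H"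
  shows "locally_integrable_on (sph_avg H) {0<..<1}"
  unfolding locally_integrable_on_def
proof (intro allI impI)
  fix K :: "real set" assume K: "compact K \<and> K \<subseteq> {0<..<1}"
  obtain a where a: "0 < a" "\<And>r. r \<in> K \<Longrightarrow> a \<le> r"
  proof (cases "K = {}")
    case True
    then show thesis
      using that[of 1] by auto
  next
    case False
    then obtain a where "a \<in> K" "\<forall>r\<in>K. a \<le> r"
      using K compact_attains_inf[of K] by auto
    then show thesis
      using that[of a] K by auto
  qed
  have KB [measurable]: "K \<in> sets borel"
    using K by (simp add: compact_imp_closed borel_closed)
  let ?n = "DIM('a)"
  define c where "c = real ?n * a ^ (?n - 1)"
  have c: "0 < c"
    using a by (simp add: c_def)
  have "integrable (unif_ball :: 'a measure) (\<lambda>x. 1 * sph_avg H (norm x))"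
    by (rule sph_avg_mult(1)[where f="\<lambda>_. 1"]) (use int in auto)
  then have i: "integrable lborel (\<lambda>r. norm_density ?n r * sph_avg H r)"
    by (subst (asm) unif_ball_integral_norm) auto
  have "integrable lborel (\<lambda>r. indicator K r * sph_avg H r)"
  proof (rule Bochner_Integration.integrable_bound)
    show "integrable lborel (\<lambda>r. inverse c * (norm_density ?n r * sph_avg H r))"
      using i by simp
    show "AE r in lborel. norm (indicator K r * sph_avg H r) \<le> norm (inverse c * (norm_density ?n r * sph_avg H r))"
    proof (rule AE_I2)
      fix r
      show "norm (indicator K r * sph_avg H r) \<le> norm (inverse c * (norm_density ?n r * sph_avg H r))"
      proof (cases "r \<in> K")
        case True
        then have "c \<le> norm_density ?n r"
          using K a(2)[OF True] a(1)
          by (auto simp: c_def norm_density_def subset_eq intro!: mult_left_mono power_mono)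
        then have "c * \<bar>sph_avg H r\<bar> \<le> norm_density ?n r * \<bar>sph_avg H r\<bar>"
          by (rule mult_right_mono) simp
        then show ?thesis
          using c True norm_density_nonneg[of ?n r] by (simp add: abs_mult field_simps)
      qed simp
    qed
  qed auto
  then show "integrable (lebesgue_on K) (sph_avg H)"
    by (subst lebesgue_on_representative(2)[where f'="sph_avg H"]) auto
qed

text \<open>For a test function $\varphi$ on $(0,1)$ the vector field $|x|^{-n}\varphi(|x|)\,x$ is $C^1$
  with compact support, since $\varphi$ vanishes near 0.  These are its components.\<close>
lemma radial_test_field:
  fixes \<phi> :: "real \<Rightarrow> real" and i :: "'a::euclidean_space"
  assumes \<phi>: "\<phi> \<in> C1_compact_support {0<..<1}"
  defines "n \<equiv> DIM('a)"
  defines "\<psi> \<equiv> \<lambda>r. \<phi> r / r ^ n"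
  defines "\<psi>' \<equiv> \<lambda>r. grad \<phi> r / r ^ n - real n * \<phi> r / r ^ (n + 1)"
  shows "(\<lambda>x. \<psi> (norm x) * (x \<bullet> i)) \<in> C1_compact_support unit_ball"
    and "grad (\<lambda>x. \<psi> (norm x) * (x \<bullet> i)) =
      (\<lambda>x. \<psi> (norm x) *\<^sub>R i + (x \<bullet> i) *\<^sub>R (\<psi>' (norm x) *\<^sub>R sgn x))"
    and "\<phi> 0 = 0" and "grad \<phi> 0 = 0"
proof -
  obtain K where K: "compact K" "K \<subseteq> {0<..<1}" and out: "\<And>r. r \<notin> K \<Longrightarrow> \<phi> r = 0" "\<And>r. r \<notin> K \<Longrightarrow> grad \<phi> r = 0"
    using C1_compact_supportE[OF \<phi>] by metis
  have "0 \<notin> K"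
    using K by auto
  then show zero: "\<phi> 0 = 0" "grad \<phi> 0 = 0"
    using out by auto
  have oK: "open (- K)"
    using K by (simp add: compact_imp_closed open_Compl)
  have d: "(\<psi> has_real_derivative \<psi>' r) (at r)" for r
  proof (cases "r \<in> K")
    case True
    then have r: "0 < r"
      using K by auto
    have "(\<phi> has_real_derivative grad \<phi> r) (at r)"
      using C1_compact_support_continuous(1)[OF \<phi>, of r] by simp
    moreover have "r * r ^ (n - 1) = r ^ n"
      by (simp add: n_def power_eq_if[of r "DIM('a)"])
    ultimately show ?thesis
      unfolding \<psi>_def \<psi>'_def using r
      by (auto intro!: derivative_eq_intros simp: field_simps)
  next
    case False
    have "((\<lambda>_. 0) has_real_derivative 0) (at r)"
      by simp
    then have "(\<psi> has_real_derivative 0) (at r)"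
      by (rule has_field_derivative_transform_within_open[OF _ oK]) (use False out in \<open>auto simp: \<psi>_def\<close>)
    then show ?thesis
      using out False by (simp add: \<psi>'_def)
  qed
  have "continuous_on ({0<..} \<union> - K) \<psi>'"
  proof (rule continuous_on_open_Un)
    have "continuous_on {0<..} (grad \<phi>)" "continuous_on {0<..} \<phi>"
      using C1_compact_support_continuous[OF \<phi>] by (auto intro: continuous_on_subset)
    then show "continuous_on {0<..} \<psi>'"
      unfolding \<psi>'_def by (intro continuous_intros) auto
    have "continuous_on (- K) (\<lambda>_. 0::real)"
      by simp
    then show "continuous_on (- K) \<psi>'"
      by (rule continuous_on_eq) (auto simp: \<psi>'_def out)
  qed (use oK in auto)
  moreover have "{0<..} \<union> - K = UNIV"
    using K by auto
  ultimately have cont: "continuous_on UNIV \<psi>'"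
    by simp
  have zero': "\<psi>' 0 = 0"
    by (simp add: \<psi>'_def zero)
  have "continuous_on UNIV \<psi>"
    by (intro continuous_at_imp_continuous_on ballI DERIV_isCont[OF d])
  then have contn: "continuous_on UNIV (\<lambda>x::'a. \<psi> (norm x))"
    by (rule continuous_on_compose2[OF _ continuous_on_norm_id]) simp
  have G: "GDERIV (\<lambda>x. \<psi> (norm x) * (x \<bullet> i)) x :> \<psi> (norm x) *\<^sub>R i + (x \<bullet> i) *\<^sub>R (\<psi>' (norm x) *\<^sub>R sgn x)" for x
  proof -
    have "GDERIV (\<lambda>x. x \<bullet> i) x :> i"
      unfolding gderiv_def by (auto intro!: derivative_eq_intros)
    then show ?thesis
      by (rule GDERIV_mult[OF GDERIV_radial[OF d zero']])
  qed
  have contG: "continuous_on UNIV (\<lambda>x. \<psi> (norm x) *\<^sub>R i + (x \<bullet> i) *\<^sub>R (\<psi>' (norm x) *\<^sub>R sgn x))"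
    by (intro continuous_intros contn continuous_on_radial_gradient[OF cont zero'])
  let ?K = "{x::'a. norm x \<in> K}"
  have sub: "?K \<subseteq> unit_ball"
    using K by auto
  have "closed (norm -` K :: 'a set)"
    using K by (intro closed_vimage compact_imp_closed continuous_intros)
  then have "compact ?K"
    using bounded_subset[OF bounded_ball sub] by (simp add: compact_eq_bounded_closed vimage_def)
  moreover have "\<psi> (norm x) * (x \<bullet> i) = 0" if "x \<notin> ?K" for x
    using that out by (simp add: \<psi>_def)
  ultimately show "(\<lambda>x. \<psi> (norm x) * (x \<bullet> i)) \<in> C1_compact_support unit_ball"
    "grad (\<lambda>x. \<psi> (norm x) * (x \<bullet> i)) =
      (\<lambda>x. \<psi> (norm x) *\<^sub>R i + (x \<bullet> i) *\<^sub>R (\<psi>' (norm x) *\<^sub>R sgn x))"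
    using C1_compact_supportI[OF G contG _ sub] by blast+
qed

text \<open>The vector field $|x|^{-n}\varphi(|x|)\,x$ has divergence $|x|^{1-n}\varphi'(|x|)$.  Testing the
  weak gradient with its components and adding up gives an identity with radial factors only; there
  spherical means may be inserted, and the factor $|x|^{1-n}$ cancels the radial density.\<close>
lemma weak_gradient_sph_avg:
  fixes u :: "'a::euclidean_space \<Rightarrow> real"
  assumes W: "has_weak_gradient_on u G unit_ball"
    and [measurable]: "U \<in> borel_measurable borel" "\<Gamma> \<in> borel_measurable borel"
    and U: "AE x in unif_ball. u x = U x" "integrable unif_ball U"
    and \<Gamma>: "AE x in unif_ball. G x \<bullet> sgn x = \<Gamma> x" "integrable unif_ball \<Gamma>"
  shows "has_weak_gradient_on (sph_avg U) (sph_avg \<Gamma>) {0<..<1}"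
  unfolding has_weak_gradient_on_def
proof (intro conjI ballI)
  show "locally_integrable_on (sph_avg U) {0<..<1}" "locally_integrable_on (sph_avg \<Gamma>) {0<..<1}"
    using U \<Gamma> by (auto intro: locally_integrable_sph_avg)
  fix \<phi> :: "real \<Rightarrow> real" and j :: real
  assume \<phi>: "\<phi> \<in> C1_compact_support {0<..<1}" and j: "j \<in> Basis"
  note [measurable] = C1_compact_support_borel[OF \<phi>]
  define n where "n = DIM('a)"
  define \<psi> where "\<psi> r = \<phi> r / r ^ n" for r
  define \<psi>' where "\<psi>' r = grad \<phi> r / r ^ n - real n * \<phi> r / r ^ (n + 1)" for r
  define f1 f2 where "f1 r = grad \<phi> r / r ^ (n - 1)" and "f2 r = \<phi> r / r ^ (n - 1)" for r
  have [measurable]: "f1 \<in> borel_measurable borel" "f2 \<in> borel_measurable borel"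
    unfolding f1_def[abs_def] f2_def[abs_def] by measurable
  have pn: "r ^ n = r * r ^ (n - 1)" for r :: real
    by (simp add: n_def power_eq_if)
  define \<eta> where "\<eta> i x = \<psi> (norm x) * (x \<bullet> i)" for i x :: 'a
  have \<eta>: "\<eta> i \<in> C1_compact_support unit_ball" for i
    using radial_test_field(1)[OF \<phi>, of i] by (simp add: \<eta>_def[abs_def] \<psi>_def n_def)
  have grad\<eta>: "grad (\<eta> i) x = \<psi> (norm x) *\<^sub>R i + (x \<bullet> i) *\<^sub>R (\<psi>' (norm x) *\<^sub>R sgn x)" for i x
    using fun_cong[OF radial_test_field(2)[OF \<phi>, of i], of x]
    by (simp add: \<eta>_def[abs_def] \<psi>_def \<psi>'_def n_def)
  note zero = radial_test_field(3,4)[OF \<phi>]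
  \<comment> \<open>The divergence is $n\psi + r\psi' = r^{1-n}(r^n\psi)' = r^{1-n}\varphi'$; at the origin all terms
      vanish, as $\varphi$ and its derivative do.\<close>
  have div: "(\<Sum>i\<in>Basis. grad (\<eta> i) x \<bullet> i) = f1 (norm x)" for x
  proof -
    have "(\<Sum>i\<in>Basis. grad (\<eta> i) x \<bullet> i) =
        (\<Sum>i\<in>Basis. \<psi> (norm x) + \<psi>' (norm x) * ((x \<bullet> i) * (sgn x \<bullet> i)))"
      by (intro sum.cong) (auto simp: grad\<eta> inner_add_left)
    also have "\<dots> = real n * \<psi> (norm x) + \<psi>' (norm x) * (x \<bullet> sgn x)"
      by (simp add: sum.distrib n_def sum_distrib_left[symmetric] euclidean_inner[symmetric])
    also have "x \<bullet> sgn x = norm x"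
      by (cases "x = 0") (simp_all add: sgn_div_norm power2_norm_eq_inner[symmetric] power2_eq_square)
    also have "real n * \<psi> (norm x) + \<psi>' (norm x) * norm x = f1 (norm x)"
      by (cases "x = 0") (simp_all add: \<psi>_def \<psi>'_def f1_def zero pn field_simps)
    finally show ?thesis .
  qed
  have rad: "(\<Sum>i\<in>Basis. (G x \<bullet> i) * \<eta> i x) = (G x \<bullet> sgn x) * f2 (norm x)" for x
  proof -
    have "(\<Sum>i\<in>Basis. (G x \<bullet> i) * \<eta> i x) = (\<Sum>i\<in>Basis. \<psi> (norm x) * ((G x \<bullet> i) * (x \<bullet> i)))"
      by (intro sum.cong) (auto simp: \<eta>_def)
    also have "\<dots> = \<psi> (norm x) * (G x \<bullet> x)"
      by (simp add: sum_distrib_left[symmetric] euclidean_inner[symmetric])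
    also have "\<dots> = (G x \<bullet> sgn x) * f2 (norm x)"
      by (cases "x = 0") (simp_all add: \<psi>_def f2_def zero pn sgn_div_norm field_simps)
    finally show ?thesis .
  qed
  have li: "locally_integrable_on u unit_ball" "locally_integrable_on (\<lambda>x. G x \<bullet> i) unit_ball" for i
    using W unfolding has_weak_gradient_on_def locally_integrable_on_def by auto
  have int1: "integrable (lebesgue_on unit_ball) (\<lambda>x. u x * (grad (\<eta> i) x \<bullet> i))" if "i \<in> Basis" for i
  proof -
    obtain K M where K: "compact K" "K \<subseteq> unit_ball" "\<And>x. x \<notin> K \<Longrightarrow> grad (\<eta> i) x = 0"
      and M: "\<And>x. norm (grad (\<eta> i) x) \<le> M"
      using C1_compact_supportE[OF \<eta>[of i]] by metis
    note [measurable] = C1_compact_support_borel[OF \<eta>[of i]]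
    show ?thesis
    proof (rule integrable_mult_test_function[OF li(1) open_ball _ K(1,2)])
      show "\<bar>grad (\<eta> i) x \<bullet> i\<bar> \<le> M" for x
        using Basis_le_norm[OF that] M order_trans by blast
    qed (use K(3) in auto)
  qed
  have int2: "integrable (lebesgue_on unit_ball) (\<lambda>x. (G x \<bullet> i) * \<eta> i x)" for i
  proof -
    obtain K M where K: "compact K" "K \<subseteq> unit_ball" "\<And>x. x \<notin> K \<Longrightarrow> \<eta> i x = 0"
      and M: "\<And>x. \<bar>\<eta> i x\<bar> \<le> M"
      using C1_compact_supportE[OF \<eta>[of i]] by metis
    show ?thesis
      by (rule integrable_mult_test_function[OF li(2) open_ball C1_compact_support_borel(1)[OF \<eta>] K M])
  qed
  have "(LINT x|lebesgue_on unit_ball. u x * f1 (norm x)) =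
      (\<Sum>i\<in>Basis. LINT x|lebesgue_on unit_ball. u x * (grad (\<eta> i) x \<bullet> i))"
    using int1 by (simp add: div[symmetric] sum_distrib_left)
  also have "\<dots> = (\<Sum>i\<in>Basis. - (LINT x|lebesgue_on unit_ball. (G x \<bullet> i) * \<eta> i x))"
    using W \<eta> by (intro sum.cong) (auto simp: has_weak_gradient_on_def)
  also have "\<dots> = - (LINT x|lebesgue_on unit_ball. (G x \<bullet> sgn x) * f2 (norm x))"
    using int2 by (simp add: rad[symmetric] sum_negf)
  finally have eq: "(LINT x|lebesgue_on unit_ball. u x * f1 (norm x)) =
      - (LINT x|lebesgue_on unit_ball. (G x \<bullet> sgn x) * f2 (norm x))" .
  have i1: "integrable (lebesgue_on unit_ball) (\<lambda>x. u x * f1 (norm x))"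
    using int1 by (simp add: div[symmetric] sum_distrib_left)
  have i2: "integrable (lebesgue_on unit_ball) (\<lambda>x. (G x \<bullet> sgn x) * f2 (norm x))"
    using int2 by (simp add: rad[symmetric])
  have ae1: "AE x in unif_ball. u x * f1 (norm x) = f1 (norm x) * U x"
    using U(1) by eventually_elim simp
  have ae2: "AE x in unif_ball. (G x \<bullet> sgn x) * f2 (norm x) = f2 (norm x) * \<Gamma> x"
    using \<Gamma>(1) by eventually_elim simp
  have m1: "(\<lambda>x. f1 (norm x) * U x) \<in> borel_measurable borel" "(\<lambda>x. f2 (norm x) * \<Gamma> x) \<in> borel_measurable borel"
    by measurable
  have J1: "integrable unif_ball (\<lambda>x. f1 (norm x) * U x)"
    using i1 lebesgue_on_unit_ball(1)[OF m1(1) ae1] by simp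
  have J2: "integrable unif_ball (\<lambda>x. f2 (norm x) * \<Gamma> x)"
    using i2 lebesgue_on_unit_ball(1)[OF m1(2) ae2] by simp
  have "(\<integral>x. f1 (norm x) * U x \<partial>unif_ball) = - (\<integral>x. f2 (norm x) * \<Gamma> x \<partial>unif_ball)"
  proof -
    have "unit_ball_vol DIM('a) * (\<integral>x. f1 (norm x) * U x \<partial>unif_ball) =
        - (unit_ball_vol DIM('a) * (\<integral>x. f2 (norm x) * \<Gamma> x \<partial>unif_ball))"
      using eq by (simp add: lebesgue_on_unit_ball(2)[OF m1(1) ae1] lebesgue_on_unit_ball(2)[OF m1(2) ae2])
    then have "unit_ball_vol DIM('a) * (\<integral>x. f1 (norm x) * U x \<partial>unif_ball) =
        unit_ball_vol DIM('a) * - (\<integral>x. f2 (norm x) * \<Gamma> x \<partial>unif_ball)"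
      by simp
    then show ?thesis
      using less_imp_neq[OF unit_ball_vol_pos[of "real DIM('a)"]] by (subst (asm) mult_cancel_left) auto
  qed
  then have "(\<integral>x. f1 (norm x) * sph_avg U (norm x) \<partial>(unif_ball :: 'a measure)) =
      - (\<integral>x. f2 (norm x) * sph_avg \<Gamma> (norm x) \<partial>(unif_ball :: 'a measure))"
    using J1 J2 by (simp add: sph_avg_mult(2))
  then have E: "(\<integral>r. norm_density n r * (f1 r * sph_avg U r) \<partial>lborel) =
      - (\<integral>r. norm_density n r * (f2 r * sph_avg \<Gamma> r) \<partial>lborel)"
    by (subst (asm) (1 2) unif_ball_integral_norm(2)) (simp_all add: n_def)
  have e1: "norm_density n r * (f1 r * sph_avg U r) = real n * (indicator {0<..<1} r * (sph_avg U r * grad \<phi> r))" for r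
    by (auto simp: norm_density_def f1_def indicator_def)
  have e2: "norm_density n r * (f2 r * sph_avg \<Gamma> r) = real n * (indicator {0<..<1} r * (sph_avg \<Gamma> r * \<phi> r))" for r
    by (auto simp: norm_density_def f2_def indicator_def)
  have n0: "real n \<noteq> 0"
    by (simp add: n_def)
  define A B where "A = (\<integral>r. indicator {0<..<1} r * (sph_avg U r * grad \<phi> r) \<partial>lborel)"
    and "B = (\<integral>r. indicator {0<..<1} r * (sph_avg \<Gamma> r * \<phi> r) \<partial>lborel)"
  have "real n * A = - (real n * B)"
    using E unfolding e1 e2 A_def B_def by simp
  then have "real n * A = real n * - B"
    by (simp only: mult_minus_right)
  then have "A = - B"
    using n0 by (simp only: mult_cancel_left) simp
  moreover have "(LINT r|lebesgue_on {0<..<1}. sph_avg U r * (grad \<phi> r \<bullet> j)) =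
      A"
    unfolding A_def using j by (intro lebesgue_on_representative(3)) auto
  moreover have "(LINT r|lebesgue_on {0<..<1}. (sph_avg \<Gamma> r \<bullet> j) * \<phi> r) =
      B"
    unfolding B_def using j by (intro lebesgue_on_representative(3)) auto
  ultimately show "(LINT r|lebesgue_on {0<..<1}. sph_avg U r * (grad \<phi> r \<bullet> j)) =
      - (LINT r|lebesgue_on {0<..<1}. (sph_avg \<Gamma> r \<bullet> j) * \<phi> r)"
    by simp
qed

section \<open>Radial functions in the weighted Sobolev space\<close>

lemma abs_power_le:
  fixes t :: real
  assumes "j \<le> m"
  shows "\<bar>t\<bar> ^ j \<le> 1 + \<bar>t\<bar> ^ m"
proof (cases "\<bar>t\<bar> \<le> 1")
  case True
  then have "\<bar>t\<bar> ^ j \<le> 1"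
    by (simp add: power_le_one)
  then show ?thesis
    by (simp add: add_increasing2)
next
  case False
  then have "\<bar>t\<bar> ^ j \<le> \<bar>t\<bar> ^ m"
    using assms by (intro power_increasing) auto
  then show ?thesis
    by simp
qed

lemma integrable_of_power:
  fixes f :: "'a::euclidean_space \<Rightarrow> real"
  assumes [measurable]: "f \<in> borel_measurable borel"
    and int: "integrable unif_ball (\<lambda>x. \<bar>f x\<bar> ^ Suc k)"
  shows "integrable unif_ball f"
proof (rule Bochner_Integration.integrable_bound)
  show "integrable unif_ball (\<lambda>x. 1 + \<bar>f x\<bar> ^ Suc k)"
    using int by simp
  show "AE x in unif_ball. norm (f x) \<le> norm (1 + \<bar>f x\<bar> ^ Suc k)"
  proof (rule AE_I2)
    fix x
    show "norm (f x) \<le> norm (1 + \<bar>f x\<bar> ^ Suc k)"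
      using abs_power_le[of 1 "Suc k" "f x"] zero_le_power_abs[of "f x" "Suc k"] by simp
  qed
qed simp

definition weight :: "nat \<Rightarrow> real \<Rightarrow> real"
  where "weight k r = r powi (1 - int k)"

lemma weight_eq:
  assumes "0 < r" "1 \<le> k"
  shows "weight k r = 1 / r ^ (k - 1)"
  using assms by (simp add: weight_def power_int_def of_nat_diff nat_diff_distrib' divide_inverse power_inverse)

lemma borel_measurable_weight [measurable]: "1 \<le> k \<Longrightarrow> weight k \<in> borel_measurable borel"
proof -
  assume k: "1 \<le> k"
  have "weight k r = (if k = 1 then 1 else inverse r ^ (k - 1))" for r
    using k by (auto simp: weight_def power_int_def nat_diff_distrib')
  then have "weight k = (\<lambda>r. if k = 1 then 1 else inverse r ^ (k - 1))"
    by (rule ext)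
  then show ?thesis
    by simp
qed

lemma weight_nonneg:
  assumes "0 \<le> r"
  shows "0 \<le> weight k r"
  using assms by (simp add: weight_def)

lemma weight_ge_1:
  assumes "0 < r" "r < 1" "1 \<le> k"
  shows "1 \<le> weight k r"
  using assms by (simp add: weight_eq power_le_one)

text \<open>The weight is $|x|^{1-k}$ and the radial density is $n r^{n-1}$, so the product stays bounded
  exactly because $k \le n$.\<close>
lemma integrable_weight:
  assumes k: "1 \<le> k" "k \<le> DIM('a::euclidean_space)"
  shows "integrable (unif_ball :: 'a measure) (\<lambda>x. weight k (norm x))"
proof (subst unif_ball_integral_norm(1))
  let ?n = "DIM('a)"
  note [measurable] = borel_measurable_weight[OF k(1)]
  show "weight k \<in> borel_measurable borel"
    by simp
  show "integrable lborel (\<lambda>r. norm_density ?n r * weight k r)"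
  proof (rule Bochner_Integration.integrable_bound)
    show "integrable lborel (\<lambda>r::real. indicator {0<..<1} r * real ?n)"
      by simp
    show "AE r in lborel. norm (norm_density ?n r * weight k r) \<le> norm (indicator {0<..<1} r * real ?n)"
    proof (rule AE_I2)
      fix r
      show "norm (norm_density ?n r * weight k r) \<le> norm (indicator {0<..<1} r * real ?n)"
      proof (cases "r \<in> {0<..<1}")
        case True
        then have r: "0 < r" "r < 1"
          by auto
        have "r ^ (?n - 1) = r ^ (?n - k) * r ^ (k - 1)"
          using k by (simp add: power_add[symmetric])
        then have "norm_density ?n r * weight k r = real ?n * r ^ (?n - k)"
          using r k by (simp add: norm_density_def weight_eq)
        also have "\<dots> \<le> real ?n"
          using r by (simp add: mult_left_le power_le_one)
        finally show ?thesis
          using r by (simp add: abs_of_nonneg norm_density_nonneg weight_nonneg)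
      qed (simp add: norm_density_def)
    qed
  qed measurable
qed

lemma borel_measurable_sgn_lebesgue: "sgn \<in> borel_measurable (lebesgue_on (S :: 'a::euclidean_space set))"
  by (intro measurable_restrict_space1 measurable_completion) simp

text \<open>Off the origin the weight is at least 1 on the unit ball, and the radial component of the weak gradient is
  bounded by its norm.  So all integrability needed for the spherical means follows from the weighted
  bound, which itself survives averaging by Jensen's inequality.\<close>
lemma weighted_sobolev_spherical_mean:
  fixes u :: "'a::euclidean_space \<Rightarrow> real"
  assumes u: "u \<in> weighted_sobolev k" and k: "1 \<le> k"
  obtains U \<Gamma> :: "'a \<Rightarrow> real" where "U \<in> borel_measurable borel" "AE x in unif_ball. u x = U x"
    "\<Gamma> \<in> borel_measurable borel"
    "has_weak_gradient_on (sph_avg U) (sph_avg \<Gamma>) {0<..<1}"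
    "integrable (unif_ball :: 'a measure) (\<lambda>x. weight k (norm x) * \<bar>sph_avg \<Gamma> (norm x)\<bar> ^ (k + 1))"
proof -
  note [measurable] = borel_measurable_weight[OF k]
  obtain G where W: "has_weak_gradient_on u G unit_ball"
    and Gint: "integrable (lebesgue_on unit_ball) (\<lambda>x. norm x powi (1 - int k) * norm (G x) ^ (k + 1))"
    and um: "u \<in> borel_measurable (lebesgue_on unit_ball)"
    and uint: "integrable (lebesgue_on unit_ball) (\<lambda>x. \<bar>u x\<bar> ^ (k + 1))"
    using u by (auto simp: weighted_sobolev_def Lp_on_def)
  have B: "(unit_ball :: 'a set) \<in> sets borel"
    by simp
  obtain U where U [measurable]: "U \<in> borel_measurable borel" and uU: "AE x in lborel. x \<in> unit_ball \<longrightarrow> u x = U x"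
    using obtain_borel_representative[OF um B] .
  have uU': "AE x in unif_ball. u x = U x"
    unfolding AE_unif_ball_iff using uU by eventually_elim auto
  have Gm: "G \<in> borel_measurable (lebesgue_on unit_ball)"
    using W by (intro locally_integrable_on_measurable) (auto simp: has_weak_gradient_on_def)
  have "(\<lambda>x. G x \<bullet> sgn x) \<in> borel_measurable (lebesgue_on unit_ball)"
    using Gm borel_measurable_sgn_lebesgue by (rule borel_measurable_inner)
  then obtain \<Gamma> where \<Gamma> [measurable]: "\<Gamma> \<in> borel_measurable borel"
    and G\<Gamma>: "AE x in lborel. x \<in> unit_ball \<longrightarrow> G x \<bullet> sgn x = \<Gamma> x"
    using obtain_borel_representative[OF _ B] by blast
  have G\<Gamma>': "AE x in unif_ball. G x \<bullet> sgn x = \<Gamma> x"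
    unfolding AE_unif_ball_iff using G\<Gamma> by eventually_elim auto
  have "integrable unif_ball (\<lambda>x. \<bar>U x\<bar> ^ (k + 1))"
  proof (subst lebesgue_on_unit_ball(1)[symmetric])
    show "AE x in unif_ball. \<bar>u x\<bar> ^ (k + 1) = \<bar>U x\<bar> ^ (k + 1)"
      using uU' by eventually_elim simp
  qed (use uint in auto)
  then have Uint: "integrable unif_ball U"
    using integrable_of_power[of U k] by simp
  have "integrable (lebesgue_on unit_ball) (\<lambda>x. norm x powi (1 - int k) * \<bar>G x \<bullet> sgn x\<bar> ^ (k + 1))"
  proof (rule Bochner_Integration.integrable_bound[OF Gint])
    have ae: "AE x in unif_ball. norm x powi (1 - int k) * \<bar>G x \<bullet> sgn x\<bar> ^ (k + 1) =
        weight k (norm x) * \<bar>\<Gamma> x\<bar> ^ (k + 1)"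
      using G\<Gamma>' by eventually_elim (simp add: weight_def)
    have "AE x in lborel. x \<in> unit_ball \<longrightarrow> norm x powi (1 - int k) * \<bar>G x \<bullet> sgn x\<bar> ^ (k + 1) =
        weight k (norm x) * \<bar>\<Gamma> x\<bar> ^ (k + 1)"
      using ae unfolding AE_unif_ball_iff by eventually_elim auto
    then show "(\<lambda>x. norm x powi (1 - int k) * \<bar>G x \<bullet> sgn x\<bar> ^ (k + 1)) \<in> borel_measurable (lebesgue_on unit_ball)"
      by (rule lebesgue_on_representative(1)[rotated 2]) (use k in auto)
    show "AE x in lebesgue_on unit_ball. norm (norm x powi (1 - int k) * \<bar>G x \<bullet> sgn x\<bar> ^ (k + 1))
        \<le> norm (norm x powi (1 - int k) * norm (G x) ^ (k + 1))"
    proof (rule AE_I2)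
      fix x :: 'a
      have "\<bar>G x \<bullet> sgn x\<bar> \<le> norm (G x) * norm (sgn x)"
        by (rule Cauchy_Schwarz_ineq2)
      also have "\<dots> \<le> norm (G x)"
        by (simp add: norm_sgn)
      finally have "\<bar>G x \<bullet> sgn x\<bar> ^ (k + 1) \<le> norm (G x) ^ (k + 1)"
        by (rule power_mono) simp
      then have "norm x powi (1 - int k) * \<bar>G x \<bullet> sgn x\<bar> ^ (k + 1) \<le> norm x powi (1 - int k) * norm (G x) ^ (k + 1)"
        by (rule mult_left_mono) simp
      moreover have "0 \<le> norm x powi (1 - int k) * \<bar>G x \<bullet> sgn x\<bar> ^ (k + 1)"
        by (intro mult_nonneg_nonneg zero_le_power zero_le_power_int) auto
      ultimately show "norm (norm x powi (1 - int k) * \<bar>G x \<bullet> sgn x\<bar> ^ (k + 1))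
          \<le> norm (norm x powi (1 - int k) * norm (G x) ^ (k + 1))"
        unfolding real_norm_def by linarith
    qed
  qed
  then have W\<Gamma>: "integrable unif_ball (\<lambda>x. weight k (norm x) * \<bar>\<Gamma> x\<bar> ^ (k + 1))"
  proof (subst (asm) lebesgue_on_unit_ball(1))
    show "AE x in unif_ball. norm x powi (1 - int k) * \<bar>G x \<bullet> sgn x\<bar> ^ (k + 1) =
        weight k (norm x) * \<bar>\<Gamma> x\<bar> ^ (k + 1)"
      using G\<Gamma>' by eventually_elim (simp add: weight_def)
  qed auto
  have P\<Gamma>: "integrable unif_ball (\<lambda>x. \<bar>\<Gamma> x\<bar> ^ (k + 1))"
  proof (rule Bochner_Integration.integrable_bound[OF W\<Gamma>])
    show "AE x in unif_ball. norm (\<bar>\<Gamma> x\<bar> ^ (k + 1)) \<le> norm (weight k (norm x) * \<bar>\<Gamma> x\<bar> ^ (k + 1))"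
      using AE_unif_ball_norm
    proof eventually_elim
      case (elim x)
      then have "1 * \<bar>\<Gamma> x\<bar> ^ (k + 1) \<le> weight k (norm x) * \<bar>\<Gamma> x\<bar> ^ (k + 1)"
        using k by (intro mult_right_mono weight_ge_1) auto
      moreover have "0 \<le> \<bar>\<Gamma> x\<bar> ^ (k + 1)"
        by simp
      ultimately show ?case
        unfolding real_norm_def by linarith
    qed
  qed simp
  then have \<Gamma>int: "integrable unif_ball \<Gamma>"
    using integrable_of_power[of \<Gamma> k] by simp
  show thesis
  proof (rule that[OF U uU' \<Gamma>])
    show "has_weak_gradient_on (sph_avg U) (sph_avg \<Gamma>) {0<..<1}"
      by (rule weak_gradient_sph_avg[OF W U \<Gamma> uU' Uint G\<Gamma>' \<Gamma>int])
    have "integrable (unif_ball :: 'a measure) (\<lambda>x. \<bar>weight k (norm x)\<bar> * \<bar>sph_avg \<Gamma> (norm x)\<bar> ^ (k + 1))"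
      by (rule integrable_sph_avg_power[where f="\<lambda>r. \<bar>weight k r\<bar>"])
        (use \<Gamma>int P\<Gamma> W\<Gamma> in \<open>auto simp: abs_of_nonneg[OF weight_nonneg]\<close>)
    then show "integrable (unif_ball :: 'a measure) (\<lambda>x. weight k (norm x) * \<bar>sph_avg \<Gamma> (norm x)\<bar> ^ (k + 1))"
      by (simp add: abs_of_nonneg[OF weight_nonneg])
  qed
qed

text \<open>The spherical means of $u$ and of the radial component of its weak gradient are a profile
  and a weak derivative of it.  So the choice that defines the radial derivative is made from a
  nonempty set, and by uniqueness of weak derivatives the chosen function equals that mean almost
  everywhere.  This gives its measurability and its weighted bound.\<close>
lemma radial_deriv_representative:
  fixes u :: "'a::euclidean_space \<Rightarrow> real"
  assumes u: "u \<in> weighted_sobolev k" and k: "1 \<le> k" and rad: "radial u"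
  obtains v w where "v \<in> borel_measurable borel" "w \<in> borel_measurable borel"
    "AE x in unif_ball. u x = v (norm x)"
    "AE x in (unif_ball :: 'a measure). radial_deriv u (norm x) = w (norm x)"
    "integrable (unif_ball :: 'a measure) (\<lambda>x. weight k (norm x) * \<bar>w (norm x)\<bar> ^ (k + 1))"
proof -
  obtain U \<Gamma> :: "'a \<Rightarrow> real" where U [measurable]: "U \<in> borel_measurable borel" and uU: "AE x in unif_ball. u x = U x"
    and \<Gamma> [measurable]: "\<Gamma> \<in> borel_measurable borel"
    and W: "has_weak_gradient_on (sph_avg U) (sph_avg \<Gamma>) {0<..<1}"
    and int: "integrable (unif_ball :: 'a measure) (\<lambda>x. weight k (norm x) * \<bar>sph_avg \<Gamma> (norm x)\<bar> ^ (k + 1))"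
    by (rule weighted_sobolev_spherical_mean[OF u k])
  \<comment> \<open>A profile is only required to match $u$ almost everywhere, so null sets on $(0,1)$ have to be
      translated into null sets of the ball and back.\<close>
  have profile_iff: "radial_profile u v \<longleftrightarrow> (AE x in unif_ball. u x = v (norm x))" for v
    unfolding radial_profile_def AE_lebesgue_on_iff[OF borel_open[OF open_ball]] AE_unif_ball_iff
    by simp
  have mean: "AE x in (unif_ball :: 'a measure). sph_avg U (norm x) = v (norm x)" if "radial_profile u v" for v
  proof (rule sph_avg_radial[OF U])
    show "AE x in unif_ball. U x = v (norm x)"
      using uU that[unfolded profile_iff] by eventually_elim simp
  qed
  obtain v0 where v0: "radial_profile u v0"
    using rad by (auto simp: radial_def)
  have uA: "AE x in unif_ball. u x = sph_avg U (norm x)"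
    using v0[unfolded profile_iff] mean[OF v0] by eventually_elim simp
  \<comment> \<open>The existence that makes the choice in the definition of the radial derivative meaningful.\<close>
  have "\<exists>w v. radial_profile u v \<and> has_weak_gradient_on v w {0<..<1}"
    using W uA profile_iff by blast
  then have "\<exists>v. radial_profile u v \<and> has_weak_gradient_on v (radial_deriv u) {0<..<1}"
    unfolding radial_deriv_def by (rule someI_ex)
  then obtain v where v: "radial_profile u v" and Wv: "has_weak_gradient_on v (radial_deriv u) {0<..<1}"
    by blast
  have "v \<in> borel_measurable (lebesgue_on {0<..<1})"
    using Wv by (intro locally_integrable_on_measurable) (auto simp: has_weak_gradient_on_def)
  then obtain v' where v' [measurable]: "v' \<in> borel_measurable borel"
    and vv': "AE r in lborel. r \<in> {0<..<1} \<longrightarrow> v r = v' r"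
    by (rule obtain_borel_representative) auto
  have "AE x in (unif_ball :: 'a measure). v (norm x) = v' (norm x)"
    by (rule AE_unif_ball_norm_if) (use vv' in \<open>auto elim!: eventually_mono\<close>)
  with mean[OF v] have "AE x in (unif_ball :: 'a measure). sph_avg U (norm x) = v' (norm x)"
    by eventually_elim simp
  then have "AE r in lborel. 0 < r \<longrightarrow> r < 1 \<longrightarrow> sph_avg U r = v' r"
    by (rule AE_unif_ball_norm_only_if[rotated]) measurable
  with vv' have "AE r in lborel. r \<in> {0<..<1} \<longrightarrow> v r = sph_avg U r"
    by eventually_elim auto
  from weak_derivative_unique[OF Wv W this]
  have "AE x in (unif_ball :: 'a measure). radial_deriv u (norm x) = sph_avg \<Gamma> (norm x)"
    by (intro AE_unif_ball_norm_if) (auto elim!: eventually_mono)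
  then show thesis
    by (intro that[of "sph_avg U" "sph_avg \<Gamma>"] uA int) auto
qed

section \<open>Radial test functions suffice\<close>

theorem theorem1p3:
  fixes u :: "real^'n \<Rightarrow> real" and g :: "real \<Rightarrow> real" and k :: nat
  assumes "1 \<le> k" and "k \<le> CARD('n)"
    and "\<forall>t. g t > 0" and "g C1_differentiable_on UNIV"
    and "u \<in> weighted_sobolev k" and "radial u"
    and "integrable (lebesgue_on unit_ball) (\<lambda>x. g (u x))"
  shows "weak_radial_solution k g u \<longleftrightarrow>
    (\<forall>\<xi> \<in> C1_compact_support unit_ball.
       (\<exists>\<zeta>. \<forall>x. \<xi> x = \<zeta> (norm x)) \<longrightarrow>
       has_bochner_integral (lebesgue_on unit_ball)
         (\<lambda>x. c_nk CARD('n) k * norm x powi (- int k) * radial_deriv u (norm x) ^ k *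
                (x \<bullet> grad \<xi> x) + g (u x) * \<xi> x) 0)"
    (is "_ \<longleftrightarrow> ?radial")
proof -
  define c where "c = c_nk CARD('n) k"
  define P where "P = (unif_ball :: (real^'n) measure)"
  \<comment> \<open>At the origin both sides use that division by 0 gives 0.\<close>
  have integrand: "c * norm x powi (- int k) * radial_deriv u (norm x) ^ k * (x \<bullet> grad \<xi> x) + g (u x) * \<xi> x =
      1 / real k * Sk_flux k u \<xi> x + g (u x) * \<xi> x" for \<xi> and x :: "real^'n"
    using assms(1) by (simp add: Sk_flux_def c_def power_int_minus divide_inverse
        power_mult_distrib power_inverse)
  obtain v w where vw [measurable]: "v \<in> borel_measurable borel" "w \<in> borel_measurable borel"
    and v: "AE x in unif_ball. u x = v (norm x)"
    and w: "AE x in P. radial_deriv u (norm x) = w (norm x)"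
    and wint: "integrable P (\<lambda>x. weight k (norm x) * \<bar>w (norm x)\<bar> ^ (k + 1))"
    unfolding P_def by (rule radial_deriv_representative[OF assms(5,1,6)])
  have "continuous_on UNIV g"
    using assms(4) C1_differentiable_imp_continuous_on by blast
  then have [measurable]: "g \<in> borel_measurable borel"
    by (rule borel_measurable_continuous_onI)
  note [measurable] = borel_measurable_weight[OF assms(1)]
  \<comment> \<open>Up to null sets both integrands are $f(|x|)$ times the radial derivative of the test function
      plus $h(|x|)$ times the test function.\<close>
  define f h where "f r = c * (w r / r) ^ k * r" and "h r = g (v r)" for r
  have [measurable]: "f \<in> borel_measurable borel" "h \<in> borel_measurable borel"
    unfolding f_def[abs_def] h_def[abs_def] by measurable
  have fw: "\<bar>f r\<bar> = \<bar>c\<bar> * (weight k r * \<bar>w r\<bar> ^ k)" if "0 < r" for r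
  proof -
    have "r ^ k = r * r ^ (k - 1)"
      using assms(1) by (cases k) auto
    then show ?thesis
      using that assms(1) by (simp add: f_def weight_eq abs_mult power_abs power_divide)
  qed
  \<comment> \<open>Since $|w|^k \le 1 + |w|^{k+1}$, the flux is dominated by the weight, integrable because
      $k \le n$, plus the weighted Sobolev bound.\<close>
  have fint: "integrable P (\<lambda>x. f (norm x))"
  proof (rule Bochner_Integration.integrable_bound)
    have "integrable P (\<lambda>x. weight k (norm x))"
      unfolding P_def by (rule integrable_weight) (use assms in auto)
    then show "integrable P (\<lambda>x. \<bar>c\<bar> * (weight k (norm x) + weight k (norm x) * \<bar>w (norm x)\<bar> ^ (k + 1)))"
      using wint by simp
    show "AE x in P. norm (f (norm x)) \<le> norm (\<bar>c\<bar> * (weight k (norm x) + weight k (norm x) * \<bar>w (norm x)\<bar> ^ (k + 1)))"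
      using AE_unif_ball_norm[where ?'a="real^'n"] unfolding P_def
    proof eventually_elim
      case (elim x)
      have "weight k (norm x) * \<bar>w (norm x)\<bar> ^ k \<le> weight k (norm x) * (1 + \<bar>w (norm x)\<bar> ^ (k + 1))"
        by (intro mult_left_mono abs_power_le weight_nonneg) auto
      then have "\<bar>c\<bar> * (weight k (norm x) * \<bar>w (norm x)\<bar> ^ k) \<le>
          \<bar>c\<bar> * (weight k (norm x) + weight k (norm x) * \<bar>w (norm x)\<bar> ^ (k + 1))"
        by (intro mult_left_mono) (simp_all add: distrib_left)
      then show ?case
        using elim fw[of "norm x"] abs_ge_self[of "\<bar>c\<bar> * (weight k (norm x) + weight k (norm x) * \<bar>w (norm x)\<bar> ^ (k + 1))"]
        unfolding real_norm_def by linarith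
    qed
  qed (simp add: P_def)
  have hint: "integrable P (\<lambda>x. h (norm x))"
  proof -
    have "AE x in unif_ball. g (u x) = h (norm x)"
      using v by eventually_elim (simp add: h_def)
    then show ?thesis
      using assms(7) unfolding P_def by (subst (asm) lebesgue_on_unit_ball(1)) auto
  qed
  have energy: "integrable (lebesgue_on unit_ball) (Sk_energy k u)"
  proof (subst lebesgue_on_unit_ball(1))
    let ?E = "\<lambda>r. real k * c * (w r / r) ^ (k - 1) * (w r)\<^sup>2"
    show "(\<lambda>x. ?E (norm x)) \<in> borel_measurable (borel :: (real^'n) measure)"
      by measurable
    show "AE x in unif_ball. Sk_energy k u x = ?E (norm x)"
      using w unfolding P_def by eventually_elim (simp add: Sk_energy_def c_def)
    show "integrable unif_ball (\<lambda>x::real^'n. ?E (norm x))"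
    proof (rule Bochner_Integration.integrable_bound)
      show "integrable unif_ball (\<lambda>x::real^'n. real k * \<bar>c\<bar> * (weight k (norm x) * \<bar>w (norm x)\<bar> ^ (k + 1)))"
        using wint unfolding P_def by simp
      show "AE x::real^'n in unif_ball. norm (?E (norm x)) \<le>
          norm (real k * \<bar>c\<bar> * (weight k (norm x) * \<bar>w (norm x)\<bar> ^ (k + 1)))"
        using AE_unif_ball_norm[where ?'a="real^'n"]
      proof eventually_elim
        case (elim x)
        have "\<bar>w (norm x)\<bar> ^ (k + 1) = \<bar>w (norm x)\<bar> ^ (k - 1) * (w (norm x))\<^sup>2"
          using assms(1) by (cases k) (auto simp: power2_eq_square)
        then show ?case
          using elim assms(1) by (simp add: weight_eq abs_mult power_abs power_divide)
      qed
    qed simp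
  qed
  have flux: "has_bochner_integral (lebesgue_on unit_ball) (\<lambda>x. 1 / real k * Sk_flux k u \<xi> x + g (u x) * \<xi> x) 0 \<longleftrightarrow>
      has_bochner_integral P (\<lambda>x. f (norm x) * (sgn x \<bullet> grad \<xi> x) + h (norm x) * \<xi> x) 0"
    if "\<xi> \<in> C1_compact_support unit_ball" for \<xi>
    unfolding P_def
  proof (rule has_bochner_integral_unit_ball_zero_iff)
    note [measurable] = C1_compact_support_borel[OF that]
    show "(\<lambda>x. f (norm x) * (sgn x \<bullet> grad \<xi> x) + h (norm x) * \<xi> x) \<in> borel_measurable borel"
      by measurable
    show "AE x in unif_ball. 1 / real k * Sk_flux k u \<xi> x + g (u x) * \<xi> x =
        f (norm x) * (sgn x \<bullet> grad \<xi> x) + h (norm x) * \<xi> x"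
      using v w AE_unif_ball_norm unfolding P_def
    proof eventually_elim
      case (elim x)
      have "x \<bullet> grad \<xi> x = norm x * (sgn x \<bullet> grad \<xi> x)"
        using elim by (simp add: sgn_div_norm)
      then show ?case
        using elim assms(1) by (simp add: Sk_flux_def c_def f_def h_def)
    qed
  qed
  have "has_bochner_integral (lebesgue_on unit_ball) (\<lambda>x. 1 / real k * Sk_flux k u \<eta> x + g (u x) * \<eta> x) 0"
    if R: ?radial and \<eta>: "\<eta> \<in> C1_compact_support unit_ball" for \<eta>
  proof -
    define \<xi> where "\<xi> x = sph_avg \<eta> (norm x)" for x :: "real^'n"
    have \<xi>: "\<xi> \<in> C1_compact_support unit_ball"
      and grad\<xi>: "grad \<xi> = (\<lambda>x. sph_avg_deriv \<eta> (norm x) *\<^sub>R sgn x)"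
      unfolding \<xi>_def[abs_def] by (rule radial_mean_test_function[OF \<eta>])+
    note [measurable] = C1_compact_support_borel[OF \<eta>] C1_compact_support_borel[OF \<xi>]
    have "has_bochner_integral P (\<lambda>x. f (norm x) * (sgn x \<bullet> grad \<xi> x) + h (norm x) * \<xi> x) 0"
    proof -
      have "\<exists>\<zeta>. \<forall>x. \<xi> x = \<zeta> (norm x)"
        unfolding \<xi>_def by blast
      from R[rule_format, OF \<xi> this] show ?thesis
        unfolding integrand[unfolded c_def] flux[OF \<xi>] .
    qed
    define H where "H x = sgn x \<bullet> grad \<eta> x" for x
    have [measurable]: "H \<in> borel_measurable borel"
      unfolding H_def[abs_def] by measurable
    obtain M where M: "\<And>x. \<bar>\<eta> x\<bar> \<le> M" "\<And>x. norm (grad \<eta> x) \<le> M"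
      using C1_compact_supportE[OF \<eta>] by metis
    have HM: "\<bar>H x\<bar> \<le> M" for x
    proof -
      have "\<bar>H x\<bar> \<le> norm (sgn x) * norm (grad \<eta> x)"
        unfolding H_def by (rule Cauchy_Schwarz_ineq2)
      also have "\<dots> \<le> norm (grad \<eta> x)"
        by (simp add: norm_sgn)
      finally show ?thesis
        using M(2)[of x] by linarith
    qed
    have bounded_mult: "integrable P (\<lambda>x. q (norm x) * Q x)"
      if "integrable P (\<lambda>x. q (norm x))" "\<And>x. \<bar>Q x\<bar> \<le> M" and [measurable]: "Q \<in> borel_measurable borel"
        "q \<in> borel_measurable borel" for q Q
    proof (rule Bochner_Integration.integrable_bound)
      show "integrable P (\<lambda>x. M * q (norm x))"
        using that(1) by simp
      show "AE x in P. norm (q (norm x) * Q x) \<le> norm (M * q (norm x))"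
      proof (rule AE_I2)
        fix x
        have "\<bar>q (norm x)\<bar> * \<bar>Q x\<bar> \<le> \<bar>q (norm x)\<bar> * \<bar>M\<bar>"
          using that(2)[of x] by (intro mult_left_mono) auto
        then show "norm (q (norm x) * Q x) \<le> norm (M * q (norm x))"
          by (simp add: abs_mult mult.commute)
      qed
    qed (simp add: P_def)
    have i1: "integrable P (\<lambda>x. f (norm x) * H x)"
      by (rule bounded_mult[OF fint HM]) measurable
    have i2: "integrable P (\<lambda>x. h (norm x) * \<eta> x)"
      by (rule bounded_mult[OF hint M(1)]) measurable
    note A1 = sph_avg_mult[OF _ _ i1[unfolded P_def], folded P_def]
    note A2 = sph_avg_mult[OF _ _ i2[unfolded P_def], folded P_def]
    have "0 = (\<integral>x. f (norm x) * (sgn x \<bullet> grad \<xi> x) + h (norm x) * \<xi> x \<partial>P)"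
      using \<open>has_bochner_integral P _ 0\<close> by (simp add: has_bochner_integral_iff)
    also have "\<dots> = (\<integral>x. f (norm x) * sph_avg H (norm x) + h (norm x) * sph_avg \<eta> (norm x) \<partial>P)"
      unfolding P_def
    proof (rule integral_cong_AE)
      show "AE x in unif_ball. f (norm x) * (sgn x \<bullet> grad \<xi> x) + h (norm x) * \<xi> x =
          f (norm x) * sph_avg H (norm x) + h (norm x) * sph_avg \<eta> (norm x)"
        using AE_unif_ball_norm
      proof eventually_elim
        case (elim x)
        then have "sgn x \<bullet> sgn x = 1"
          by (simp add: power2_norm_eq_inner[symmetric] norm_sgn)
        then have "sgn x \<bullet> grad \<xi> x = sph_avg H (norm x)"
          using elim unfolding grad\<xi> H_def[abs_def] by (simp add: sph_avg_deriv_eq[symmetric])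
        then show ?case
          by (simp add: \<xi>_def)
      qed
    qed measurable
    also have "\<dots> = (\<integral>x. f (norm x) * H x \<partial>P) + (\<integral>x. h (norm x) * \<eta> x \<partial>P)"
      using A1 A2 by simp
    also have "\<dots> = (\<integral>x. f (norm x) * H x + h (norm x) * \<eta> x \<partial>P)"
      using i1 i2 by simp
    finally have "has_bochner_integral P (\<lambda>x. f (norm x) * H x + h (norm x) * \<eta> x) 0"
      using i1 i2 by (simp add: has_bochner_integral_iff)
    then show ?thesis
      unfolding flux[OF \<eta>] H_def .
  qed
  moreover have "\<exists>G. has_weak_gradient_on u G unit_ball" "u \<in> Lp_on (k + 1) unit_ball"
    using assms(5) by (auto simp: weighted_sobolev_def)
  ultimately show ?thesis
    unfolding weak_radial_solution_def integrand[unfolded c_def]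
    using energy assms(6,7) by blast
qed

end
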